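(* Let $H$ be a semisimple Hopf algebra over an algebraically closed field $k$ of characteristic $0$, and let $z_n\in H$ be the elements built from the idempotent integral of $H$ (defined in the context). Then the following are equivalent: (i) $H$ is commutative; (ii) $z_n\in k$ for some $n\ge2$; (iii) $z_n\in k$ for all $n\ge 2$.
   Context: $k$ is identified with $k\cdot 1_H\subset H$. $H$ is finite dimensional with comultiplication $\Delta(h)=\sum h_1\otimes h_2$ (Sweedler notation), counit $\varepsilon$ and antipode $S$. $\Lambda$ denotes the idempotent integral of $H$: $h\Lambda=\varepsilon(h)\Lambda=\Lambda h$ for all $h\in H$ and $\varepsilon(\Lambda)=1$. Let $\Lambda^1,\Lambda^2,\dots$ be copies of $\Lambda$ with $\Delta(\Lambda^i)=\sum\Lambda^i_1\otimes\Lambda^i_2$. For $n\ge1$, $$z_n=\sum\Lambda^1_1\Lambda^2_1\cdots\Lambda^n_1\,S(\Lambda^1_2)S(\Lambda^2_2)\cdots S(\Lambda^n_2).$$ *)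

theory Defs
  imports "HOL-Computational_Algebra.Polynomial"
begin

section \<open>Tensor products\<close>

text \<open>
  A formal sum of simple tensors is a list, so that concatenation is addition. Scalars are
  absorbed into the entries of the simple tensors. \<open>formal_sum_eq G\<close> is the congruence of the
  free commutative monoid on \<open>'x\<close> generated by the relations \<open>G\<close>.
\<close>

inductive formal_sum_eq :: "('x list \<times> 'x list) set \<Rightarrow> 'x list \<Rightarrow> 'x list \<Rightarrow> bool"
  for G :: "('x list \<times> 'x list) set" where
  gen: "(xs, ys) \<in> G \<Longrightarrow> formal_sum_eq G xs ys"
| refl: "formal_sum_eq G xs xs"
| sym: "formal_sum_eq G xs ys \<Longrightarrow> formal_sum_eq G ys xs"
| trans: "formal_sum_eq G xs ys \<Longrightarrow> formal_sum_eq G ys zs \<Longrightarrow> formal_sum_eq G xs zs"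
| comm: "formal_sum_eq G (xs @ ys) (ys @ xs)"
| append: "formal_sum_eq G xs ys \<Longrightarrow> formal_sum_eq G us vs \<Longrightarrow> formal_sum_eq G (xs @ us) (ys @ vs)"

definition formal_sum_class :: "('x list \<times> 'x list) set \<Rightarrow> 'x list \<Rightarrow> 'x list set" where
  "formal_sum_class G xs = {ys. formal_sum_eq G xs ys}"

text \<open>
  The relations defining \<open>H \<otimes>\<^sub>k H\<close> and \<open>H \<otimes>\<^sub>k H \<otimes>\<^sub>k H\<close>. The \<open>zero\<close> rules make the quotient
  monoid a group, with \<open>- (a \<otimes> b) = (- a) \<otimes> b\<close>.
\<close>

inductive_set tensor2_rel ::
  "('k::field \<Rightarrow> 'h::ab_group_add \<Rightarrow> 'h) \<Rightarrow> (('h \<times> 'h) list \<times> ('h \<times> 'h) list) set"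
  for scale :: "'k \<Rightarrow> 'h \<Rightarrow> 'h" where
  zero: "([(0, b)], []) \<in> tensor2_rel scale"
| add1: "([(a + a', b)], [(a, b), (a', b)]) \<in> tensor2_rel scale"
| add2: "([(a, b + b')], [(a, b), (a, b')]) \<in> tensor2_rel scale"
| balanced: "([(scale c a, b)], [(a, scale c b)]) \<in> tensor2_rel scale"

inductive_set tensor3_rel ::
  "('k::field \<Rightarrow> 'h::ab_group_add \<Rightarrow> 'h) \<Rightarrow> (('h \<times> 'h \<times> 'h) list \<times> ('h \<times> 'h \<times> 'h) list) set"
  for scale :: "'k \<Rightarrow> 'h \<Rightarrow> 'h" where
  zero: "([(0, b, c)], []) \<in> tensor3_rel scale"
| add1: "([(a + a', b, c)], [(a, b, c), (a', b, c)]) \<in> tensor3_rel scale"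
| add2: "([(a, b + b', c)], [(a, b, c), (a, b', c)]) \<in> tensor3_rel scale"
| add3: "([(a, b, c + c')], [(a, b, c), (a, b, c')]) \<in> tensor3_rel scale"
| balanced12: "([(scale r a, b, c)], [(a, scale r b, c)]) \<in> tensor3_rel scale"
| balanced23: "([(a, scale r b, c)], [(a, b, scale r c)]) \<in> tensor3_rel scale"

abbreviation tensor2 ::
  "('k::field \<Rightarrow> 'h::ab_group_add \<Rightarrow> 'h) \<Rightarrow> ('h \<times> 'h) list \<Rightarrow> ('h \<times> 'h) list set" where
  "tensor2 scale \<equiv> formal_sum_class (tensor2_rel scale)"

abbreviation tensor3 ::
  "('k::field \<Rightarrow> 'h::ab_group_add \<Rightarrow> 'h) \<Rightarrow> ('h \<times> 'h \<times> 'h) list \<Rightarrow> ('h \<times> 'h \<times> 'h) list set" where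
  "tensor3 scale \<equiv> formal_sum_class (tensor3_rel scale)"

lemma formal_sum_class_eq_iff:
  "formal_sum_class G xs = formal_sum_class G ys \<longleftrightarrow> formal_sum_eq G xs ys"
  unfolding formal_sum_class_def
  by (auto intro: formal_sum_eq.refl formal_sum_eq.sym formal_sum_eq.trans)

lemma tensor2_lift:
  fixes f :: "'h::ab_group_add \<Rightarrow> 'h \<Rightarrow> 'a::ab_group_add"
  assumes add1: "\<And>a a' b. f (a + a') b = f a b + f a' b"
    and add2: "\<And>a b b'. f a (b + b') = f a b + f a b'"
    and balanced: "\<And>c a b. f (scale c a) b = f a (scale c b)"
    and eq: "formal_sum_eq (tensor2_rel scale) xs ys"
  shows "(\<Sum>(a, b)\<leftarrow>xs. f a b) = (\<Sum>(a, b)\<leftarrow>ys. f a b)"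
  using eq
proof induction
  case (gen xs ys)
  have "f 0 b = 0" for b using add1[of 0 0 b] by simp
  with gen show ?case
    by cases (auto simp: add1 add2 balanced)
qed (auto simp: add_ac)

section \<open>Hopf algebras\<close>

locale unital_algebra = vector_space scale
  for scale :: "'k::field \<Rightarrow> 'h::ring_1 \<Rightarrow> 'h" +
  assumes scale_mult_left: "scale c a * b = scale c (a * b)"
    and scale_mult_right: "a * scale c b = scale c (a * b)"

text \<open>
  \<open>sweedler \<Delta> h\<close> is a chosen representative \<open>[(h\<^sub>1, h\<^sub>2), \<dots>]\<close> of \<open>\<Delta> h = \<Sum> h\<^sub>1 \<otimes> h\<^sub>2\<close>. Every use
  below is multilinear in the tensor and so does not depend on the choice.
\<close>

definition sweedler :: "('h \<Rightarrow> ('h \<times> 'h) list set) \<Rightarrow> 'h \<Rightarrow> ('h \<times> 'h) list" where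
  "sweedler \<Delta> h = (SOME xs. xs \<in> \<Delta> h)"

locale hopf_algebra = unital_algebra scale
  for scale :: "'k::field \<Rightarrow> 'h::ring_1 \<Rightarrow> 'h" +
  fixes comult :: "'h \<Rightarrow> ('h \<times> 'h) list set"
    and counit :: "'h \<Rightarrow> 'k"
    and antipode :: "'h \<Rightarrow> 'h"
  assumes comult_tensor: "comult h \<in> range (tensor2 scale)"
    and comult_add: "comult (g + h) = tensor2 scale (sweedler comult g @ sweedler comult h)"
    and comult_scale: "comult (scale c h) = tensor2 scale [(scale c a, b). (a, b) \<leftarrow> sweedler comult h]"
    and linear_counit: "Vector_Spaces.linear scale (*) counit"
    and coassoc:
      "tensor3 scale [(x, y, b). (a, b) \<leftarrow> sweedler comult h, (x, y) \<leftarrow> sweedler comult a] =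
       tensor3 scale [(a, x, y). (a, b) \<leftarrow> sweedler comult h, (x, y) \<leftarrow> sweedler comult b]"
    and counit_left: "(\<Sum>(a, b)\<leftarrow>sweedler comult h. scale (counit a) b) = h"
    and counit_right: "(\<Sum>(a, b)\<leftarrow>sweedler comult h. scale (counit b) a) = h"
    and comult_one: "comult 1 = tensor2 scale [(1, 1)]"
    and comult_mult:
      "comult (g * h) =
       tensor2 scale [(a * a', b * b'). (a, b) \<leftarrow> sweedler comult g, (a', b') \<leftarrow> sweedler comult h]"
    and counit_one: "counit 1 = 1"
    and counit_mult: "counit (g * h) = counit g * counit h"
    and linear_antipode: "Vector_Spaces.linear scale scale antipode"
    and antipode_left: "(\<Sum>(a, b)\<leftarrow>sweedler comult h. antipode a * b) = scale (counit h) 1"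
    and antipode_right: "(\<Sum>(a, b)\<leftarrow>sweedler comult h. a * antipode b) = scale (counit h) 1"

section \<open>Semisimplicity\<close>

definition left_ideal :: "'h::ring_1 set \<Rightarrow> bool" where
  "left_ideal I \<longleftrightarrow> 0 \<in> I \<and> (\<forall>x\<in>I. \<forall>y\<in>I. x + y \<in> I) \<and> (\<forall>h. \<forall>x\<in>I. h * x \<in> I)"

text \<open>
  The left regular module is semisimple: every submodule is a direct summand. In a unital algebra
  the left ideals are automatically subspaces.
\<close>

definition semisimple_ring :: "'h::ring_1 itself \<Rightarrow> bool" where
  "semisimple_ring _ \<longleftrightarrow>
     (\<forall>I :: 'h set. left_ideal I \<longrightarrow>
        (\<exists>J. left_ideal J \<and> I \<inter> J = {0} \<and> {x + y |x y. x \<in> I \<and> y \<in> J} = UNIV))"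

section \<open>The idempotent integral and the elements \<open>z\<^sub>n\<close>\<close>

definition is_idempotent_integral ::
  "('k::field \<Rightarrow> 'h::ring_1 \<Rightarrow> 'h) \<Rightarrow> ('h \<Rightarrow> 'k) \<Rightarrow> 'h \<Rightarrow> bool" where
  "is_idempotent_integral scale counit t \<longleftrightarrow>
     (\<forall>h. h * t = scale (counit h) t \<and> t * h = scale (counit h) t) \<and> counit t = 1"

definition idempotent_integral :: "('k::field \<Rightarrow> 'h::ring_1 \<Rightarrow> 'h) \<Rightarrow> ('h \<Rightarrow> 'k) \<Rightarrow> 'h" where
  "idempotent_integral scale counit = (THE t. is_idempotent_integral scale counit t)"

text \<open>
  \<open>List.n_lists n xs\<close> enumerates, with multiplicity, the \<open>n\<close>-tuples of summands of \<open>xs\<close>: the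
  \<open>i\<close>-th entry is a summand \<open>(\<Lambda>\<^sup>i\<^sub>1, \<Lambda>\<^sup>i\<^sub>2)\<close> of the \<open>i\<close>-th copy of \<open>\<Delta> \<Lambda>\<close>.
\<close>

definition z_sum :: "('h::ring_1 \<Rightarrow> 'h) \<Rightarrow> ('h \<times> 'h) list \<Rightarrow> nat \<Rightarrow> 'h" where
  "z_sum antipode xs n =
     (\<Sum>ps\<leftarrow>List.n_lists n xs. prod_list (map fst ps) * prod_list (map (\<lambda>p. antipode (snd p)) ps))"

definition z_elem ::
  "('k::field \<Rightarrow> 'h::ring_1 \<Rightarrow> 'h) \<Rightarrow> ('h \<Rightarrow> ('h \<times> 'h) list set) \<Rightarrow> ('h \<Rightarrow> 'k) \<Rightarrow> ('h \<Rightarrow> 'h) \<Rightarrow> nat \<Rightarrow> 'h"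
  where
  "z_elem scale comult counit antipode n =
     z_sum antipode (sweedler comult (idempotent_integral scale counit)) n"

section \<open>Well-definedness\<close>

context unital_algebra
begin

lemma z_sum_cong:
  assumes S: "Vector_Spaces.linear scale scale S"
    and eq: "formal_sum_eq (tensor2_rel scale) xs ys"
  shows "z_sum S xs n = z_sum S ys n"
proof -
  have S_add: "S (a + b) = S a + S b" and S_scale: "S (scale c a) = scale c (S a)" for a b c
    using S unfolding Vector_Spaces.linear_iff by auto
  let ?t = "\<lambda>l m ps. l * prod_list (map fst ps) * m * prod_list (map (\<lambda>p. S (snd p)) ps)"
  have swap: "(\<Sum>ps\<leftarrow>List.n_lists (Suc n) zs. g ps) = (\<Sum>p\<leftarrow>zs. \<Sum>ps\<leftarrow>List.n_lists n zs. g (p # ps))"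
    for n :: nat and zs :: "('h \<times> 'h) list" and g :: "_ \<Rightarrow> 'h"
  proof -
    have "(\<Sum>ps\<leftarrow>qs. \<Sum>p\<leftarrow>zs. g (p # ps)) = (\<Sum>p\<leftarrow>zs. \<Sum>ps\<leftarrow>qs. g (p # ps))" for qs
      by (induction qs) (simp_all add: sum_list_addf)
    moreover have "(\<Sum>ps\<leftarrow>concat (map (\<lambda>ys. map (\<lambda>y. y # ys) zs) qs). g ps) =
        (\<Sum>ps\<leftarrow>qs. \<Sum>p\<leftarrow>zs. g (p # ps))" for qs
      by (induction qs) (simp_all add: comp_def)
    ultimately show ?thesis by simp
  qed
  have "(\<Sum>ps\<leftarrow>List.n_lists n xs. ?t l m ps) = (\<Sum>ps\<leftarrow>List.n_lists n ys. ?t l m ps)" for l m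
  proof (induction n arbitrary: l m)
    case (Suc n)
    have "(\<Sum>ps\<leftarrow>List.n_lists (Suc n) xs. ?t l m ps) =
        (\<Sum>p\<leftarrow>xs. \<Sum>ps\<leftarrow>List.n_lists n xs. ?t (l * fst p) (m * S (snd p)) ps)"
      unfolding swap by (simp add: mult.assoc)
    also have "\<dots> = (\<Sum>p\<leftarrow>xs. \<Sum>ps\<leftarrow>List.n_lists n ys. ?t (l * fst p) (m * S (snd p)) ps)"
      by (simp only: Suc)
    also have "\<dots> = (\<Sum>(a, b)\<leftarrow>xs. \<Sum>ps\<leftarrow>List.n_lists n ys. ?t (l * a) (m * S b) ps)"
      by (simp only: case_prod_unfold)
    also have "\<dots> = (\<Sum>(a, b)\<leftarrow>ys. \<Sum>ps\<leftarrow>List.n_lists n ys. ?t (l * a) (m * S b) ps)"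
      by (rule tensor2_lift[OF _ _ _ eq])
        (simp_all add: S_add S_scale distrib_left distrib_right sum_list_addf
          scale_mult_left scale_mult_right)
    also have "\<dots> = (\<Sum>p\<leftarrow>ys. \<Sum>ps\<leftarrow>List.n_lists n ys. ?t (l * fst p) (m * S (snd p)) ps)"
      by (simp only: case_prod_unfold)
    also have "\<dots> = (\<Sum>ps\<leftarrow>List.n_lists (Suc n) ys. ?t l m ps)"
      unfolding swap by (simp add: mult.assoc)
    finally show ?case .
  qed simp
  from this[of 1 1] show ?thesis by (simp add: z_sum_def)
qed

end

context hopf_algebra
begin

lemma sweedler_in: "sweedler comult h \<in> comult h"
proof -
  obtain xs where "comult h = tensor2 scale xs" using comult_tensor by blast
  then have "xs \<in> comult h" by (simp add: formal_sum_class_def formal_sum_eq.refl)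
  then show ?thesis unfolding sweedler_def by (rule someI)
qed

lemma comult_eq: "comult h = tensor2 scale (sweedler comult h)"
proof -
  obtain xs where xs: "comult h = tensor2 scale xs" using comult_tensor by blast
  with sweedler_in[of h] have "formal_sum_eq (tensor2_rel scale) xs (sweedler comult h)"
    by (simp add: formal_sum_class_def)
  with xs show ?thesis by (simp add: formal_sum_class_eq_iff)
qed

lemma z_elem_eq:
  assumes "xs \<in> comult (idempotent_integral scale counit)"
  shows "z_elem scale comult counit antipode n = z_sum antipode xs n"
proof -
  have "formal_sum_eq (tensor2_rel scale) (sweedler comult (idempotent_integral scale counit)) xs"
    using assms comult_eq[of "idempotent_integral scale counit"] by (simp add: formal_sum_class_def)
  from z_sum_cong[OF linear_antipode this] show ?thesis by (simp add: z_elem_def)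
qed

lemma ex1_idempotent_integral:
  assumes "semisimple_ring TYPE('h)"
  shows "\<exists>!t. is_idempotent_integral scale counit t"
proof -
  interpret counit: Vector_Spaces.linear scale "(*)" counit by (rule linear_counit)
  let ?K = "{h. counit h = 0}"
  have compl: "\<exists>J. left_ideal J \<and> I \<inter> J = {0} \<and> {x + y |x y. x \<in> I \<and> y \<in> J} = UNIV"
    if "left_ideal I" for I :: "'h set"
    using assms that unfolding semisimple_ring_def by blast
  have "left_ideal ?K"
    by (auto simp: left_ideal_def counit.add counit_mult)
  from compl[OF this] obtain L where L: "left_ideal L" "?K \<inter> L = {0}"
    "{x + y |x y. x \<in> ?K \<and> y \<in> L} = UNIV" by blast
  have "1 \<in> {x + y |x y. x \<in> ?K \<and> y \<in> L}" using L(3) by simp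
  then obtain e t where et: "1 = e + t" "counit e = 0" "t \<in> L" by blast
  have t1: "counit t = 1"
    using counit_one et counit.add[of e t] by simp
  have Kt: "h * t = 0" if "counit h = 0" for h
  proof -
    have "h * t \<in> L" using L(1) et(3) by (auto simp: left_ideal_def)
    moreover have "h * t \<in> ?K" using that by (simp add: counit_mult)
    ultimately show ?thesis using L(2) by blast
  qed
  have counit_unit: "counit (scale c 1) = c" for c by (simp add: counit.scale counit_one)
  have split: "counit (h - scale (counit h) 1) = 0" for h
    by (simp add: counit.diff counit_unit)
  have left: "h * t = scale (counit h) t" for h
    using Kt[OF split[of h]] by (simp add: algebra_simps scale_mult_left)
  let ?N = "{t * h |h. counit h = 0}"
  have N: "left_ideal ?N"
    unfolding left_ideal_def
  proof (intro conjI ballI allI)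
    show "0 \<in> ?N" by (auto intro!: exI[of _ 0])
  next
    fix x y assume "x \<in> ?N" "y \<in> ?N"
    then obtain a b where "x = t * a" "y = t * b" "counit a = 0" "counit b = 0" by blast
    then show "x + y \<in> ?N" by (auto intro!: exI[of _ "a + b"] simp: distrib_left counit.add)
  next
    fix h x assume "x \<in> ?N"
    then obtain a where a: "x = t * a" "counit a = 0" by blast
    have "h * x = t * scale (counit h) a"
      by (simp add: a mult.assoc[symmetric] left scale_mult_left scale_mult_right)
    with a show "h * x \<in> ?N" by (auto intro!: exI[of _ "scale (counit h) a"] simp: counit.scale)
  qed
  from compl[OF N] obtain M where M: "left_ideal M" "?N \<inter> M = {0}"
    "{x + y |x y. x \<in> ?N \<and> y \<in> M} = UNIV" by blast
  have "1 \<in> {x + y |x y. x \<in> ?N \<and> y \<in> M}" using M(3) by simp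
  then obtain u v where uv: "1 = t * u + v" "counit u = 0" "v \<in> M" by blast
  have tK: "t * h = 0" if "counit h = 0" for h
  proof -
    have "t * h * (t * u) = t * (h * t) * u" by (simp add: mult.assoc)
    then have "t * h * (t * u) = 0" using Kt[OF that] by simp
    moreover have "t * h * 1 = t * h * (t * u) + t * h * v"
      unfolding uv(1) by (rule distrib_left)
    ultimately have "t * h = t * h * v" by simp
    moreover have "t * h * v \<in> M" using M(1) uv(3) by (auto simp: left_ideal_def)
    moreover have "t * h \<in> ?N" using that by blast
    ultimately show ?thesis using M(2) by auto
  qed
  have right: "t * h = scale (counit h) t" for h
    using tK[OF split[of h]] by (simp add: algebra_simps scale_mult_right)
  show ?thesis
  proof (rule ex1I[of _ t])
    show "is_idempotent_integral scale counit t"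
      using left right t1 by (simp add: is_idempotent_integral_def)
  next
    fix s assume "is_idempotent_integral scale counit s"
    then have "t * s = scale (counit t) s" "t * s = scale (counit s) t" "counit s = 1"
      using right[of s] by (simp_all only: is_idempotent_integral_def)
    then show "s = t" using t1 by simp
  qed
qed

end

end

theory Submission
  imports Defs "HOL-Computational_Algebra.Fundamental_Theorem_Algebra"
begin

text \<open>
  If \<open>H\<close> is commutative, the factors of \<open>z\<^sub>n\<close> can be regrouped as a product of \<open>n\<close> copies of
  \<open>\<Sum> \<Lambda>\<^sub>1 S(\<Lambda>\<^sub>2) = \<epsilon>(\<Lambda>) 1 = 1\<close>, so every \<open>z\<^sub>n\<close> is \<open>1\<close>. The work lies in the converse: a single scalar
  \<open>z\<^sub>n\<close> with \<open>n \<ge> 2\<close> makes \<open>H\<close> commutative.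

  The element \<open>\<Sum> \<Lambda>\<^sub>1 \<otimes> S(\<Lambda>\<^sub>2)\<close> commutes with \<open>H\<close>, like a Casimir element. Schur's lemma therefore
  determines its action on a minimal left ideal \<open>V\<close> of dimension \<open>d\<close> (\<open>casimir_schur\<close>): there it is
  \<open>\<Sum> E\<^sub>i\<^sub>j \<otimes> Q E\<^sub>j\<^sub>i\<close> with \<open>Q = q / d\<close>, where \<open>q = \<Sum> S(\<Lambda>\<^sub>2) \<Lambda>\<^sub>1\<close> satisfies \<open>q h = S\<^sup>2(h) q\<close>, and
  \<open>tr Q = 1\<close>. The element \<open>Q\<close> is called the pivot of \<open>V\<close>. A contraction of indices shows that \<open>z\<^sub>n\<close>
  acts on \<open>V\<close> as \<open>Q\<^sup>n\<close> for even \<open>n\<close> and as \<open>tr(Q\<^sup>m\<^sup>+\<^sup>1) Q\<^sup>m\<close> for \<open>n = 2 m + 1\<close> (\<open>z_action_even\<close>,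
  \<open>z_action_odd\<close>). If \<open>z\<^sub>n\<close> is a scalar, the trivial module shows that the scalar is \<open>1\<close>, and it follows
  that \<open>Q\<^sup>N = 1\<close> on every \<open>V\<close>, with one exponent \<open>N > 0\<close> (\<open>pivot_finite_order\<close>).

  It remains to deduce \<open>S\<^sup>2 = id\<close>. For then \<open>q = 1\<close>, the pivot is \<open>1 / d\<close>, and \<open>Q\<^sup>N = 1\<close> forces
  \<open>d = 1\<close> for all \<open>V\<close>, so that \<open>H\<close> is commutative. The argument is that of Larson and Radford, with
  \<open>Q\<^sup>N = 1\<close> as additional input. Since \<open>tr Q = 1\<close> is a sum of roots of unity, \<open>tr Q\<^sup>-\<^sup>1\<close> is its complex
  conjugate, again \<open>1\<close> (\<open>trace_inverse_of_finite_order\<close>). Summing the functionals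
  \<open>h \<mapsto> tr\<^sub>V (Q\<^sup>-\<^sup>1 h)\<close> over the irreducible characters gives a Frobenius functional which
  turns out to be \<open>\<lambda>(h) = Tr (x \<mapsto> S\<^sup>2(x) h)\<close>; hence \<open>Tr S\<^sup>2 = \<lambda>(1)\<close> is the number of irreducible
  characters and is not \<open>0\<close>. Moreover \<open>\<lambda>\<close> is an integral (\<open>trace_integral_right_integral\<close>). Because
  \<open>\<lambda>(1) \<noteq> 0\<close> it is invariant under \<open>S\<close>, and together with \<open>\<lambda>(a b) = \<lambda>(S\<^sup>2(b) a)\<close> this yields
  \<open>S\<^sup>4 = id\<close> (\<open>sq_sq\<close>).

  Finally let \<open>x\<close> be the character of the regular comodule and \<open>D = dim H\<close>. From \<open>x\<^sup>2 = D x\<close>,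
  \<open>S\<^sup>2(x) = x\<close> and \<open>\<lambda>(x) = \<lambda>(1)\<close> one obtains \<open>Tr S\<^sup>2 = D t\<close>, where \<open>t\<close> is the trace of the involution
  induced by \<open>S\<^sup>2\<close> on \<open>H x\<close>, an integer. But \<open>Tr S\<^sup>2\<close> is a nonzero difference of the multiplicities of
  the eigenvalues \<open>1\<close> and \<open>-1\<close>, which add up to \<open>D\<close>. So one multiplicity vanishes, and \<open>S(1) = 1\<close>
  leaves only \<open>S\<^sup>2 = id\<close> (\<open>antipode_involution\<close>).
\<close>

section \<open>Rational relations between roots of unity\<close>

definition rat_eval :: "'a::field_char_0 \<Rightarrow> rat poly \<Rightarrow> 'a" where
  "rat_eval x p = poly (map_poly of_rat p) x"

lemma rat_eval_pCons [simp]: "rat_eval x (pCons a p) = of_rat a + x * rat_eval x p"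
  by (simp add: rat_eval_def map_poly_pCons)

lemma rat_eval_0 [simp]: "rat_eval x 0 = 0"
  by (simp add: rat_eval_def)

lemma rat_eval_1 [simp]: "rat_eval x 1 = 1"
  by (simp add: rat_eval_def)

lemma rat_eval_add [simp]: "rat_eval x (p + q) = rat_eval x p + rat_eval x q"
  by (induction p q rule: poly_induct2) (simp_all add: of_rat_add algebra_simps)

lemma rat_eval_smult [simp]: "rat_eval x (smult a p) = of_rat a * rat_eval x p"
  by (induction p) (simp_all add: of_rat_mult algebra_simps)

lemma rat_eval_mult [simp]: "rat_eval x (p * q) = rat_eval x p * rat_eval x q"
  by (induction p) (simp_all add: algebra_simps)

lemma rat_eval_uminus [simp]: "rat_eval x (- p) = - rat_eval x p"
  using rat_eval_smult[of x "-1" p] by (simp del: rat_eval_smult)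

lemma rat_eval_diff [simp]: "rat_eval x (p - q) = rat_eval x p - rat_eval x q"
  using rat_eval_add[of x p "- q"] by (simp del: rat_eval_add)

lemma rat_eval_monom [simp]: "rat_eval x (monom a n) = of_rat a * x ^ n"
  by (induction n) (simp_all add: monom_0 monom_Suc algebra_simps)

lemma rat_eval_sum [simp]: "rat_eval x (sum p A) = (\<Sum>i\<in>A. rat_eval x (p i))"
  by (induction A rule: infinite_finite_induct) simp_all

lemma rat_eval_cnj: "rat_eval (cnj x) p = cnj (rat_eval x p)"
proof (induction p)
  case (pCons a p)
  have "cnj (of_rat a) = of_rat a"
    by (cases a) (simp add: of_rat_rat)
  with pCons show ?case by simp
qed simp

lemma minimal_polynomial_exists:
  fixes x :: "'a::field_char_0"
  assumes "p \<noteq> 0" "rat_eval x p = 0"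
  obtains m where "rat_eval x m = 0" "degree m > 0"
    "\<And>q. rat_eval x q = 0 \<Longrightarrow> m dvd q"
proof -
  define m where "m = arg_min degree (\<lambda>q. q \<noteq> 0 \<and> rat_eval x q = 0)"
  have m: "m \<noteq> 0" "rat_eval x m = 0"
    using arg_min_natI[of "\<lambda>q. q \<noteq> 0 \<and> rat_eval x q = 0" p degree] assms
    by (auto simp: m_def)
  have min: "degree m \<le> degree q" if "q \<noteq> 0" "rat_eval x q = 0" for q
    unfolding m_def by (rule arg_min_nat_le) (use that in auto)
  have "m dvd q" if "rat_eval x q = 0" for q
  proof -
    have "rat_eval x (q mod m) = rat_eval x (q - (q div m) * m)"
      by (simp add: minus_div_mult_eq_mod del: rat_eval_diff rat_eval_mult)
    also have "\<dots> = 0"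
      using that m by simp
    finally have "rat_eval x (q mod m) = 0" .
    then have "q mod m = 0"
      using min[of "q mod m"] degree_mod_less'[of m q] m(1) by fastforce
    then show ?thesis by (simp add: mod_eq_0_iff_dvd)
  qed
  moreover have "degree m > 0"
  proof (rule ccontr)
    assume "\<not> degree m > 0"
    then obtain c where "m = [:c:]" by (metis degree_eq_zeroE gr0I)
    with m show False by simp
  qed
  ultimately show thesis using that m by blast
qed

text \<open>
  An algebraic element of any field of characteristic \<open>0\<close> satisfies the same rational equations as
  some complex number. This makes complex conjugation available over \<open>k\<close>. If \<open>w\<close> is a complex root
  of the minimal polynomial \<open>m\<close> of \<open>x\<close>, the minimal polynomial \<open>n\<close> of \<open>w\<close> divides \<open>m\<close>, and it
  vanishes at \<open>x\<close> since the cofactor has too small a degree to do so.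
\<close>

lemma algebraic_conjugate_in_complex:
  fixes x :: "'a::field_char_0"
  assumes "p \<noteq> 0" "rat_eval x p = 0"
  obtains w :: complex where "\<And>q. rat_eval w q = 0 \<longleftrightarrow> rat_eval x q = 0"
proof -
  obtain m where m: "rat_eval x m = 0" "degree m > 0" "\<And>q. rat_eval x q = 0 \<Longrightarrow> m dvd q"
    using minimal_polynomial_exists[OF assms] by metis
  have "degree (map_poly of_rat m :: complex poly) = degree m"
    by (rule degree_map_poly) auto
  then obtain w :: complex where w: "rat_eval w m = 0"
    using m(2) alg_closed_imp_poly_has_root[of "map_poly of_rat m :: complex poly"]
    by (auto simp: rat_eval_def)
  from m(2) have "m \<noteq> 0" by auto
  then obtain n where n: "rat_eval w n = 0" "degree n > 0" "\<And>q. rat_eval w q = 0 \<Longrightarrow> n dvd q"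
    using minimal_polynomial_exists[OF _ w] by metis
  from n(3)[OF w] obtain r where r: "m = n * r" by (auto elim: dvdE)
  have "r \<noteq> 0" "n \<noteq> 0" using r \<open>m \<noteq> 0\<close> by auto
  have "rat_eval x r \<noteq> 0"
  proof
    assume "rat_eval x r = 0"
    then have "degree m \<le> degree r" using m(3) \<open>r \<noteq> 0\<close> by (simp add: dvd_imp_degree_le)
    then show False using r n(2) \<open>r \<noteq> 0\<close> \<open>n \<noteq> 0\<close> by (simp add: degree_mult_eq)
  qed
  then have xn: "rat_eval x n = 0" using m(1) r by simp
  show thesis
  proof (rule that)
    fix q show "rat_eval w q = 0 \<longleftrightarrow> rat_eval x q = 0"
      using n(3)[of q] m(3)[of q] xn w by (auto elim!: dvdE)
  qed
qed

text \<open>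
  Over the complex numbers inversion of roots of unity is complex conjugation, which fixes \<open>1\<close>.
\<close>

lemma rational_sum_of_roots_of_unity_inverse:
  fixes z :: "'a::field_char_0" and m :: "'i \<Rightarrow> nat" and e :: "'i \<Rightarrow> nat"
  assumes "z ^ N = 1" "N > 0" and sum: "(\<Sum>i\<in>I. of_nat (m i) * z ^ e i) = 1"
  shows "(\<Sum>i\<in>I. of_nat (m i) * z ^ (e i * (N - 1))) = 1"
proof -
  let ?p = "monom 1 N - 1 :: rat poly"
  have "?p \<noteq> 0"
  proof
    assume "?p = 0"
    then have "coeff ?p N = 0" by simp
    then show False using \<open>N > 0\<close> by simp
  qed
  moreover have "rat_eval z ?p = 0" using assms(1) by simp
  ultimately obtain w :: complex where w: "\<And>q. rat_eval w q = 0 \<longleftrightarrow> rat_eval z q = 0"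
    using algebraic_conjugate_in_complex[of ?p z] by metis
  have "w ^ N = 1" using w[of ?p] \<open>rat_eval z ?p = 0\<close> by simp
  have cnj: "cnj w = w ^ (N - 1)"
  proof -
    have "norm w ^ N = 1" using \<open>w ^ N = 1\<close> by (metis norm_one norm_power)
    then have "norm w = 1" using \<open>N > 0\<close> power_eq_imp_eq_base[of "norm w" N 1] by simp
    then have "w * cnj w = 1" by (simp flip: complex_norm_square)
    moreover have "w * w ^ (N - 1) = 1" using \<open>w ^ N = 1\<close> \<open>N > 0\<close> by (simp add: power_eq_if)
    ultimately show ?thesis
      by (metis mult_cancel_left mult_zero_left zero_neq_one)
  qed
  let ?f = "(\<Sum>i\<in>I. monom (of_nat (m i)) (e i)) - 1 :: rat poly"
  let ?g = "(\<Sum>i\<in>I. monom (of_nat (m i)) (e i * (N - 1))) - 1 :: rat poly"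
  have "rat_eval w ?f = 0" using w[of ?f] sum by simp
  then have "rat_eval (cnj w) ?f = 0" by (simp only: rat_eval_cnj complex_cnj_zero)
  then have "rat_eval w ?g = 0" by (simp add: cnj power_mult [symmetric] mult.commute)
  then have "rat_eval z ?g = 0" using w by blast
  then show ?thesis by simp
qed

text \<open>
  The order is built up one prime \<open>p\<close> at a time: extract a \<open>p\<close>-th root if \<open>p\<close> divides the order
  already reached, and multiply by a nontrivial \<open>p\<close>-th root of unity otherwise.
\<close>

lemma root_of_unity_of_order_exists:
  assumes "N > 0"
  obtains z :: "'a::{alg_closed_field, field_char_0}"
  where "z ^ N = 1" "\<And>i. 0 < i \<Longrightarrow> i < N \<Longrightarrow> z ^ i \<noteq> 1"
proof -
  have gcd1: "y ^ gcd a b = 1" if "y ^ a = 1" "y ^ b = 1" for y :: 'a and a b :: nat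
  proof (cases "a = 0")
    case False
    then obtain u v where "a * u = b * v + gcd a b" using bezout_nat by blast
    then have "y ^ (a * u) = y ^ (b * v) * y ^ gcd a b" by (simp add: power_add)
    with that show ?thesis by (simp add: power_mult)
  qed (use that in simp)
  have "\<exists>z :: 'a. z ^ N = 1 \<and> (\<forall>r. prime r \<longrightarrow> r dvd N \<longrightarrow> z ^ (N div r) \<noteq> 1)"
    using assms
  proof (induction N rule: prime_divisors_induct)
    case (factor p n)
    then obtain z :: 'a where z: "z ^ n = 1" "\<And>r. prime r \<Longrightarrow> r dvd n \<Longrightarrow> z ^ (n div r) \<noteq> 1"
      by auto
    have p: "p > 0" "p \<noteq> 1" using factor prime_gt_0_nat by auto
    show ?case
    proof (cases "p dvd n")
      case True
      obtain y where y: "y ^ p = z" using nth_root_exists p(1) by metis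
      have "y ^ (p * n div r) \<noteq> 1" if "prime r" "r dvd p * n" for r
      proof -
        have "r dvd n" using that True by (metis dvd_trans prime_dvd_mult_iff)
        then have "p * n div r = p * (n div r)" by (simp add: div_mult_swap)
        then show ?thesis using y z(2)[OF that(1) \<open>r dvd n\<close>] by (simp add: power_mult)
      qed
      moreover have "y ^ (p * n) = 1" using y z by (simp add: power_mult)
      ultimately show ?thesis by blast
    next
      case False
      let ?h = "\<Sum>i<p. monom 1 i :: 'a poly"
      have "poly ?h 1 = of_nat p" by (simp add: poly_sum poly_monom)
      have "degree ?h > 0"
      proof -
        have "coeff ?h (p - 1) = 1" using p by (simp add: coeff_sum)
        then have "p - 1 \<le> degree ?h" by (intro le_degree) simp
        moreover have "p - 1 > 0" using p by simp
        ultimately show ?thesis by linarith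
      qed
      then obtain y where y: "poly ?h y = 0" using alg_closed_imp_poly_has_root by blast
      then have y1: "y \<noteq> 1" using \<open>poly ?h 1 = of_nat p\<close> p by auto
      have "y ^ p - 1 = (y - 1) * (\<Sum>i<p. y ^ i)" by (rule power_diff_1_eq)
      also have "\<dots> = 0" using y by (simp add: poly_sum poly_monom)
      finally have yp: "y ^ p = 1" by simp
      have "(z * y) ^ (p * n div r) \<noteq> 1" if r: "prime r" "r dvd p * n" for r
      proof (cases "r = p")
        case True
        have "y ^ n \<noteq> 1"
        proof
          assume "y ^ n = 1"
          then have "y ^ gcd p n = 1" using gcd1 yp by blast
          moreover have "gcd p n = 1"
            using False \<open>prime p\<close> by (metis coprime_imp_gcd_eq_1 prime_imp_coprime)
          ultimately show False using y1 by simp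
        qed
        then show ?thesis using True p z(1) by (simp add: power_mult_distrib)
      next
        case rp: False
        then have "r dvd n" using r \<open>prime p\<close> by (metis prime_dvd_mult_iff primes_dvd_imp_eq)
        then have eq: "p * n div r = p * (n div r)" by (simp add: div_mult_swap)
        have "z ^ (p * (n div r)) \<noteq> 1"
        proof
          assume "z ^ (p * (n div r)) = 1"
          then have "z ^ gcd (p * (n div r)) n = 1" using gcd1 z(1) by blast
          moreover have "gcd (p * (n div r)) n = n div r"
          proof -
            have "gcd (p * (n div r)) n = gcd (p * (n div r)) (r * (n div r))"
              using \<open>r dvd n\<close> by simp
            also have "\<dots> = gcd p r * (n div r)" by (simp add: gcd_mult_right gcd.commute flip: gcd_mult_distrib_nat mult.commute)
            also have "gcd p r = 1" using rp r \<open>prime p\<close>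
              by (metis coprime_imp_gcd_eq_1 primes_coprime)
            finally show ?thesis by simp
          qed
          ultimately show False using z(2)[OF r(1) \<open>r dvd n\<close>] by simp
        qed
        then show ?thesis using yp by (simp add: eq power_mult_distrib power_mult)
      qed
      moreover have "(z * y) ^ (p * n) = 1"
      proof -
        have "z ^ (p * n) = 1" using z(1) by (metis mult.commute power_mult power_one)
        moreover have "y ^ (p * n) = 1" using yp by (simp add: power_mult)
        ultimately show ?thesis by (simp add: power_mult_distrib)
      qed
      ultimately show ?thesis by blast
    qed
  qed (auto intro: exI[of _ 1] dest: prime_gt_1_nat)
  then obtain z :: 'a where z: "z ^ N = 1" "\<And>r. prime r \<Longrightarrow> r dvd N \<Longrightarrow> z ^ (N div r) \<noteq> 1"
    by blast
  have "z ^ i \<noteq> 1" if "0 < i" "i < N" for i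
  proof
    assume "z ^ i = 1"
    then have g: "z ^ gcd i N = 1" using gcd1 z(1) by blast
    have "gcd i N dvd N" by simp
    then obtain c where c: "N = gcd i N * c" unfolding dvd_def by blast
    have "c \<noteq> 1" using c that by (metis gcd_le1_nat leD mult.right_neutral neq0_conv)
    then obtain r where r: "prime r" "r dvd c" using prime_factor_nat by blast
    then obtain b where b: "c = r * b" by (auto elim: dvdE)
    have "N = r * (gcd i N * b)" using c b by (metis mult.assoc mult.left_commute)
    then have "N div r = gcd i N * b" "r dvd N"
      using prime_gt_0_nat[OF r(1)] by (metis nonzero_mult_div_cancel_left not_gr0, metis dvd_triv_left)
    then show False using z(2)[OF r(1)] g by (simp add: power_mult)
  qed
  with z(1) show thesis using that by blast
qed

section \<open>Traces\<close>

locale fin_dim_space = vector_space scale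
  for scale :: "'a::field \<Rightarrow> 'b::ab_group_add \<Rightarrow> 'b" +
  assumes finite_dim: "\<exists>B. finite_dimensional_vector_space scale B"
begin

abbreviation lin :: "('b \<Rightarrow> 'b) \<Rightarrow> bool" where
  "lin \<equiv> Vector_Spaces.linear scale scale"

abbreviation functional :: "('b \<Rightarrow> 'a) \<Rightarrow> bool" where
  "functional \<equiv> Vector_Spaces.linear scale (*)"

lemma lin_iff: "lin f \<longleftrightarrow> (\<forall>x y. f (x + y) = f x + f y) \<and> (\<forall>c x. f (scale c x) = scale c (f x))"
  using vector_space_axioms by (simp add: Vector_Spaces.linear_iff)

lemma functional_iff:
  "functional f \<longleftrightarrow> (\<forall>x y. f (x + y) = f x + f y) \<and> (\<forall>c x. f (scale c x) = c * f x)"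
proof -
  have "vector_space ((*) :: 'a \<Rightarrow> 'a \<Rightarrow> 'a)" by unfold_locales (simp_all add: algebra_simps)
  then show ?thesis using vector_space_axioms by (simp add: Vector_Spaces.linear_iff)
qed

lemma lin_add: "lin f \<Longrightarrow> f (x + y) = f x + f y"
  and lin_scale: "lin f \<Longrightarrow> f (scale c x) = scale c (f x)"
  by (simp_all add: lin_iff)

lemma lin_zero: "lin f \<Longrightarrow> f 0 = 0"
  using lin_add[of f 0 0] by simp

lemma lin_diff: "lin f \<Longrightarrow> f (x - y) = f x - f y"
  using lin_add[of f "x - y" y] by simp

lemma lin_sum: "lin f \<Longrightarrow> f (sum g A) = (\<Sum>i\<in>A. f (g i))"
  by (induction A rule: infinite_finite_induct) (simp_all add: lin_add lin_zero)

lemma lin_sum_list: "lin f \<Longrightarrow> f (sum_list xs) = sum_list (map f xs)"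
  by (induction xs) (simp_all add: lin_add lin_zero)

lemma functional_add: "functional f \<Longrightarrow> f (x + y) = f x + f y"
  and functional_scale: "functional f \<Longrightarrow> f (scale c x) = c * f x"
  by (simp_all add: functional_iff)

lemma functional_zero: "functional f \<Longrightarrow> f 0 = 0"
  using functional_scale[of f 0 0] by simp

lemma functional_diff: "functional f \<Longrightarrow> f (x - y) = f x - f y"
  using functional_add[of f "x - y" y] by simp

lemma functional_sum: "functional f \<Longrightarrow> f (sum g A) = (\<Sum>i\<in>A. f (g i))"
  by (induction A rule: infinite_finite_induct) (simp_all add: functional_add functional_zero)

lemma functional_sum_list: "functional f \<Longrightarrow> f (sum_list xs) = sum_list (map f xs)"
  by (induction xs) (simp_all add: functional_add functional_zero)

lemma lin_ident [simp]: "lin (\<lambda>x. x)"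
  by (simp add: lin_iff)

lemma lin_zero_map [simp]: "lin (\<lambda>x. 0)"
  by (simp add: lin_iff)

lemma lin_plus [simp]: "lin f \<Longrightarrow> lin g \<Longrightarrow> lin (\<lambda>x. f x + g x)"
  by (simp add: lin_iff algebra_simps)

lemma lin_minus [simp]: "lin f \<Longrightarrow> lin g \<Longrightarrow> lin (\<lambda>x. f x - g x)"
  by (simp add: lin_iff algebra_simps)

lemma lin_uminus [simp]: "lin f \<Longrightarrow> lin (\<lambda>x. - f x)"
  by (simp add: lin_iff)

lemma lin_scale_left [simp]: "lin f \<Longrightarrow> lin (\<lambda>x. scale c (f x))"
  by (simp add: lin_iff algebra_simps)

lemma lin_scale_right [simp]: "functional f \<Longrightarrow> lin (\<lambda>x. scale (f x) v)"
  by (simp add: lin_iff functional_iff algebra_simps)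

lemma lin_setsum [simp]: "(\<And>i. i \<in> I \<Longrightarrow> lin (f i)) \<Longrightarrow> lin (\<lambda>x. \<Sum>i\<in>I. f i x)"
  by (induction I rule: infinite_finite_induct) simp_all

lemma lin_listsum [simp]: "(\<And>i. i \<in> set xs \<Longrightarrow> lin (f i)) \<Longrightarrow> lin (\<lambda>x. \<Sum>i\<leftarrow>xs. f i x)"
  by (induction xs) simp_all

lemma lin_comp: "lin g \<Longrightarrow> lin f \<Longrightarrow> lin (\<lambda>x. g (f x))"
  by (simp add: lin_iff)

lemma functional_comp: "functional g \<Longrightarrow> lin f \<Longrightarrow> functional (\<lambda>x. g (f x))"
  by (simp add: lin_iff functional_iff)

lemma functional_setsum [simp]: "(\<And>i. i \<in> I \<Longrightarrow> functional (f i)) \<Longrightarrow> functional (\<lambda>x. \<Sum>i\<in>I. f i x)"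
  by (induction I rule: infinite_finite_induct) (simp_all add: functional_iff algebra_simps)

lemma lin_funpow: "lin f \<Longrightarrow> lin (f ^^ n)"
  by (induction n) (simp_all add: lin_iff)

text \<open>
  A \<open>frame\<close> of a subspace is a finite spanning set together with coordinate functionals that are
  defined on the whole space. Working with globally defined functionals keeps all linear maps
  total.
\<close>

definition frame :: "'b set \<Rightarrow> 'b set \<Rightarrow> ('b \<Rightarrow> 'b \<Rightarrow> 'a) \<Rightarrow> bool" where
  "frame V B k \<longleftrightarrow> finite B \<and> B \<subseteq> V \<and> (\<forall>b. functional (k b)) \<and>
     (\<forall>x\<in>V. (\<Sum>b\<in>B. scale (k b x) b) = x)"

definition trace :: "'b set \<Rightarrow> ('b \<Rightarrow> 'b) \<Rightarrow> 'a" where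
  "trace V f = (case (SOME (B, k). frame V B k) of (B, k) \<Rightarrow> \<Sum>b\<in>B. k b (f b))"

lemma frame_functional: "frame V B k \<Longrightarrow> functional (k b)"
  and frame_subset: "frame V B k \<Longrightarrow> b \<in> B \<Longrightarrow> b \<in> V"
  and frame_expand: "frame V B k \<Longrightarrow> x \<in> V \<Longrightarrow> (\<Sum>b\<in>B. scale (k b x) b) = x"
  by (auto simp: frame_def)

text \<open>The interchange of summation behind \<open>tr (g \<circ> f) = tr (f \<circ> g)\<close>.\<close>

lemma frame_sum_commute:
  assumes B: "frame V B k" and C: "frame W C l" and "lin f" "lin g"
    and f: "f ` V \<subseteq> W" and g: "g ` W \<subseteq> V"
  shows "(\<Sum>b\<in>B. k b (g (f b))) = (\<Sum>c\<in>C. l c (f (g c)))"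
proof -
  have "(\<Sum>b\<in>B. k b (g (f b))) = (\<Sum>b\<in>B. k b (g (\<Sum>c\<in>C. scale (l c (f b)) c)))"
  proof (rule sum.cong[OF HOL.refl])
    fix x assume "x \<in> B"
    then have "f x \<in> W" using f frame_subset[OF B] by blast
    from frame_expand[OF C this] show "k x (g (f x)) = k x (g (\<Sum>c\<in>C. scale (l c (f x)) c))" by simp
  qed
  also have "\<dots> = (\<Sum>b\<in>B. \<Sum>c\<in>C. l c (f b) * k b (g c))"
    by (simp add: lin_sum[OF \<open>lin g\<close>] lin_scale[OF \<open>lin g\<close>] functional_sum[OF frame_functional[OF B]]
        functional_scale[OF frame_functional[OF B]])
  also have "\<dots> = (\<Sum>c\<in>C. \<Sum>b\<in>B. l c (f b) * k b (g c))"
    by (rule sum.swap)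
  also have "\<dots> = (\<Sum>c\<in>C. l c (f (\<Sum>b\<in>B. scale (k b (g c)) b)))"
    by (simp add: lin_sum[OF \<open>lin f\<close>] lin_scale[OF \<open>lin f\<close>] functional_sum[OF frame_functional[OF C]]
        functional_scale[OF frame_functional[OF C]] mult.commute)
  also have "\<dots> = (\<Sum>c\<in>C. l c (f (g c)))"
  proof (rule sum.cong[OF HOL.refl])
    fix x assume "x \<in> C"
    then have "g x \<in> V" using g frame_subset[OF C] by blast
    from frame_expand[OF B this] show "l x (f (\<Sum>b\<in>B. scale (k b (g x)) b)) = l x (f (g x))" by simp
  qed
  finally show ?thesis .
qed

lemma frame_exists:
  assumes V: "subspace V"
  obtains B k where "frame V B k" "card B = dim V" "\<And>b. b \<in> B \<Longrightarrow> k b b = 1"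
proof -
  obtain E where "finite_dimensional_vector_space scale E" using finite_dim by blast
  then interpret fd: finite_dimensional_vector_space scale E .
  obtain B where B: "B \<subseteq> V" "independent B" "V \<subseteq> span B" "card B = dim V"
    using basis_exists by blast
  have fin: "finite B" using B(2) by (rule fd.finiteI_independent)
  let ?X = "extend_basis B"
  have X: "independent ?X" "span ?X = UNIV" "B \<subseteq> ?X"
    using B(2) by (simp_all add: independent_extend_basis extend_basis_superset)
  let ?k = "\<lambda>b x. representation ?X x b"
  have functional: "functional (?k b)" for b
    unfolding functional_iff using X(1,2)
    by (auto simp: representation_add representation_scale)
  have "(\<Sum>b\<in>B. scale (?k b x) b) = x" if "x \<in> V" for x
  proof -
    have "representation ?X x = representation B x"
      using B X that by (metis representation_extend subsetD)
    moreover have "(\<Sum>b\<in>B. scale (representation B x b) b) = x"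
      using B fin that by (intro sum_representation_eq) auto
    ultimately show ?thesis by simp
  qed
  then have "frame V B ?k" using fin B(1) functional by (simp add: frame_def)
  moreover have "?k b b = 1" if "b \<in> B" for b
    using X that by (auto simp: representation_basis)
  ultimately show thesis using that B(4) by blast
qed

lemma trace_eq:
  assumes "subspace V" "lin f" "f ` V \<subseteq> V" "frame V B k"
  shows "trace V f = (\<Sum>b\<in>B. k b (f b))"
proof -
  obtain C l where C: "(SOME (B, k). frame V B k) = (C, l)" by fastforce
  have "case (SOME (B, k). frame V B k) of (B, k) \<Rightarrow> frame V B k"
    by (rule someI_ex) (use assms(4) in auto)
  then have "frame V C l" by (simp add: C)
  from frame_sum_commute[OF this assms(4) \<open>lin f\<close> lin_ident] assms(3) show ?thesis
    by (simp add: trace_def C)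
qed

lemma trace_commute:
  assumes "subspace V" "subspace W" "lin f" "lin g" "f ` V \<subseteq> W" "g ` W \<subseteq> V"
  shows "trace V (\<lambda>x. g (f x)) = trace W (\<lambda>x. f (g x))"
proof -
  obtain B k where B: "frame V B k" using frame_exists assms(1) by blast
  obtain C l where C: "frame W C l" using frame_exists assms(2) by blast
  have "trace V (\<lambda>x. g (f x)) = (\<Sum>b\<in>B. k b (g (f b)))"
    by (rule trace_eq[OF assms(1) _ _ B]) (use assms in \<open>auto intro: lin_comp\<close>)
  moreover have "trace W (\<lambda>x. f (g x)) = (\<Sum>c\<in>C. l c (f (g c)))"
    by (rule trace_eq[OF assms(2) _ _ C]) (use assms in \<open>auto intro: lin_comp\<close>)
  ultimately show ?thesis using frame_sum_commute[OF B C assms(3-6)] by simp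
qed

lemma trace_cong:
  assumes "subspace V" "lin f" "lin g" "f ` V \<subseteq> V" "\<And>x. x \<in> V \<Longrightarrow> f x = g x"
  shows "trace V f = trace V g"
proof -
  obtain B k where B: "frame V B k" using frame_exists assms(1) by blast
  have "g ` V \<subseteq> V" using assms(4,5) by force
  then have "trace V f = (\<Sum>b\<in>B. k b (f b))" "trace V g = (\<Sum>b\<in>B. k b (g b))"
    using trace_eq[OF _ _ _ B] assms by blast+
  then show ?thesis using frame_subset[OF B] assms(5) by simp
qed

lemma trace_ident: "subspace V \<Longrightarrow> trace V (\<lambda>x. x) = of_nat (dim V)"
proof -
  assume V: "subspace V"
  obtain B k where B: "frame V B k" "card B = dim V" "\<And>b. b \<in> B \<Longrightarrow> k b b = 1"
    using frame_exists[OF V] by metis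
  then show ?thesis using trace_eq[OF V lin_ident _ B(1)] by simp
qed

lemma trace_scale:
  assumes "subspace V" "lin f" "f ` V \<subseteq> V"
  shows "trace V (\<lambda>x. scale c (f x)) = c * trace V f"
proof -
  obtain B k where B: "frame V B k" using frame_exists assms(1) by blast
  have "(\<lambda>x. scale c (f x)) ` V \<subseteq> V" using assms by (auto intro: subspace_scale)
  then show ?thesis
    using trace_eq[OF assms B] trace_eq[OF assms(1) lin_scale_left[OF assms(2)] _ B]
    by (simp add: functional_scale[OF frame_functional[OF B]] sum_distrib_left)
qed

lemma trace_sum:
  assumes "subspace V" "\<And>i. i \<in> I \<Longrightarrow> lin (f i)" "\<And>i. i \<in> I \<Longrightarrow> f i ` V \<subseteq> V"
  shows "trace V (\<lambda>x. \<Sum>i\<in>I. f i x) = (\<Sum>i\<in>I. trace V (f i))"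
proof -
  obtain B k where B: "frame V B k" using frame_exists assms(1) by blast
  have "(\<lambda>x. \<Sum>i\<in>I. f i x) ` V \<subseteq> V" using assms by (auto intro!: subspace_sum)
  then have "trace V (\<lambda>x. \<Sum>i\<in>I. f i x) = (\<Sum>b\<in>B. k b (\<Sum>i\<in>I. f i b))"
    using trace_eq[OF assms(1) _ _ B] assms by simp
  also have "\<dots> = (\<Sum>i\<in>I. \<Sum>b\<in>B. k b (f i b))"
    by (simp add: functional_sum[OF frame_functional[OF B]]) (rule sum.swap)
  also have "\<dots> = (\<Sum>i\<in>I. trace V (f i))"
    using assms by (simp add: trace_eq[OF _ _ _ B])
  finally show ?thesis .
qed

lemma trace_add:
  assumes "subspace V" "lin f" "lin g" "f ` V \<subseteq> V" "g ` V \<subseteq> V"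
  shows "trace V (\<lambda>x. f x + g x) = trace V f + trace V g"
  using trace_sum[of V "{True, False}" "\<lambda>i. if i then f else g"] assms by simp

lemma trace_diff:
  assumes "subspace V" "lin f" "lin g" "f ` V \<subseteq> V" "g ` V \<subseteq> V"
  shows "trace V (\<lambda>x. f x - g x) = trace V f - trace V g"
proof -
  have "(\<lambda>x. scale (- 1) (g x)) ` V \<subseteq> V" using assms by (auto intro: subspace_neg)
  then show ?thesis
    using trace_add[of V f "\<lambda>x. scale (- 1) (g x)"] trace_scale[of V g "- 1"] assms
    by simp
qed

text \<open>
  The trace of a projection on \<open>V\<close> is the trace of the identity on its image, by cyclicity.
\<close>

lemma trace_idempotent:
  assumes V: "subspace V" and p: "lin p" "p ` V \<subseteq> V" "\<And>x. x \<in> V \<Longrightarrow> p (p x) = p x"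
  shows "trace V p = of_nat (dim (p ` V))"
proof -
  have W: "subspace (p ` V)"
    using Vector_Spaces.linear.axioms(3)[OF p(1)] V by (rule module_hom.subspace_image)
  have "trace V p = trace (p ` V) p"
    using trace_commute[OF V W p(1) lin_ident] p(2) by simp
  also have "\<dots> = trace (p ` V) (\<lambda>x. x)"
    by (rule trace_cong[OF W p(1) lin_ident]) (use p in auto)
  finally show ?thesis using trace_ident[OF W] by simp
qed

end

locale fin_dim_space_closed = fin_dim_space scale
  for scale :: "'a::{alg_closed_field, field_char_0} \<Rightarrow> 'b::ab_group_add \<Rightarrow> 'b"
begin

text \<open>
  An operator of finite order \<open>N\<close> is diagonalised by the projections onto its eigenspaces, which
  are polynomials in the operator. Its trace is a sum of \<open>N\<close>-th roots of unity, and the trace of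
  the inverse is the sum of their inverses; a rational sum is not changed by this.
\<close>

lemma trace_inverse_of_finite_order:
  assumes V: "subspace V" and f: "lin f" "f ` V \<subseteq> V" "\<And>x. x \<in> V \<Longrightarrow> (f ^^ N) x = x"
    and "N > 0" and tr: "trace V f = 1"
  shows "trace V (f ^^ (N - 1)) = 1"
proof -
  obtain z :: 'a where z: "z ^ N = 1" "\<And>i. 0 < i \<Longrightarrow> i < N \<Longrightarrow> z ^ i \<noteq> 1"
    using root_of_unity_of_order_exists[OF \<open>N > 0\<close>] by blast
  have "z \<noteq> 0" using z(1) \<open>N > 0\<close> by (cases N) auto
  have inj: "i = j" if "z ^ i = z ^ j" "i < N" "j < N" for i j
    using that
  proof (induction i j rule: linorder_wlog)
    case (le i j)
    then have "z ^ j = z ^ i * z ^ (j - i)" by (metis le_add_diff_inverse power_add)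
    then have "z ^ (j - i) = 1" using le \<open>z \<noteq> 0\<close> by simp
    then show ?case using z(2)[of "j - i"] le by linarith
  qed auto
  let ?fj = "\<lambda>j. f ^^ j"
  have fj: "lin (?fj j)" for j by (rule lin_funpow[OF f(1)])
  have fjV: "(f ^^ j) x \<in> V" if "x \<in> V" for j x
    using that f(2) by (induction j) auto
  \<comment> \<open>The projection onto the eigenspace of \<open>z ^ a\<close>, by discrete Fourier inversion of the powers of \<open>f\<close>.\<close>
  define P where "P a x = scale (1 / of_nat N) (\<Sum>j<N. scale (1 / z ^ (a * j)) ((f ^^ j) x))" for a x
  have linP: "lin (P a)" for a
    unfolding P_def [abs_def] by (intro lin_scale_left lin_setsum fj)
  have PV: "P a x \<in> V" if "x \<in> V" for a x
    unfolding P_def by (intro subspace_scale subspace_sum V fjV that)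
  have geom: "(\<Sum>a<N. (z ^ i / z ^ j) ^ a) = (if i = j then of_nat N else 0)"
    if "i < N" "j < N" for i j
  proof (cases "i = j")
    case False
    let ?w = "z ^ i / z ^ j"
    have "?w \<noteq> 1" using inj[of i j] that False \<open>z \<noteq> 0\<close> by auto
    moreover have "?w ^ N = 1"
      using z(1) \<open>z \<noteq> 0\<close>
      by (simp add: power_divide flip: power_mult) (simp add: mult.commute power_mult)
    moreover have "(\<Sum>a<N. w ^ a) = 0" if "w \<noteq> 1" "w ^ N = 1" for w :: 'a
      using that by (simp add: sum_gp_strict)
    ultimately have "(\<Sum>a<N. ?w ^ a) = 0" by blast
    then show ?thesis using False by simp
  qed (use \<open>z \<noteq> 0\<close> \<open>N > 0\<close> in simp)
  have expand: "(\<Sum>a<N. scale (z ^ (a * i)) (P a x)) = (f ^^ i) x" if "i < N" for i x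
  proof -
    have "(\<Sum>a<N. scale (z ^ (a * i)) (P a x)) =
        (\<Sum>a<N. \<Sum>j<N. scale (1 / of_nat N * (z ^ i / z ^ j) ^ a) ((f ^^ j) x))"
      by (intro sum.cong HOL.refl)
        (simp add: P_def scale_sum_right power_divide mult_ac flip: power_mult)
    also have "\<dots> = (\<Sum>j<N. \<Sum>a<N. scale (1 / of_nat N * (z ^ i / z ^ j) ^ a) ((f ^^ j) x))"
      by (rule sum.swap)
    also have "\<dots> = (\<Sum>j<N. scale (1 / of_nat N * (\<Sum>a<N. (z ^ i / z ^ j) ^ a)) ((f ^^ j) x))"
      by (simp add: sum_distrib_left scale_sum_left)
    also have "\<dots> = (\<Sum>j<N. if i = j then (f ^^ j) x else 0)"
      using \<open>N > 0\<close> by (intro sum.cong HOL.refl) (simp add: geom that)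
    finally show ?thesis using that by simp
  qed
  have eig: "f (P a x) = scale (z ^ a) (P a x)" if "x \<in> V" for a x
  proof -
    let ?g = "\<lambda>j. scale (1 / z ^ (a * j)) ((f ^^ j) x)"
    have "?g N = ?g 0"
      using z(1) f(3)[OF that] by (simp add: mult.commute[of a] power_mult)
    then have "(\<Sum>j<N. ?g (Suc j)) = (\<Sum>j<N. ?g j)"
      using sum.lessThan_Suc[of ?g N] sum.lessThan_Suc_shift[of ?g N] by (simp add: add.commute)
    moreover have "f (P a x) = scale (z ^ a) (scale (1 / of_nat N) (\<Sum>j<N. ?g (Suc j)))"
      using \<open>z \<noteq> 0\<close>
      by (simp add: P_def lin_scale[OF f(1)] lin_sum[OF f(1)] scale_sum_right power_add)
    ultimately show ?thesis by (simp add: P_def)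
  qed
  have eigj: "(f ^^ j) (P a x) = scale (z ^ (a * j)) (P a x)" if "x \<in> V" for j a x
    by (induction j) (simp_all add: eig that lin_scale[OF f(1)] power_add)
  have "P a (P a x) = P a x" if "x \<in> V" for a x
  proof -
    have "P a (P a x) = scale (1 / of_nat N) (\<Sum>j<N. P a x)"
      by (subst (1) P_def) (use \<open>z \<noteq> 0\<close> in \<open>simp add: eigj that\<close>)
    also have "\<dots> = P a x"
      using \<open>N > 0\<close> scale_left_distrib
      by (simp add: sum_constant_scale)
    finally show ?thesis .
  qed
  then have trP: "trace V (P a) = of_nat (dim (P a ` V))" for a
    using PV by (intro trace_idempotent V linP) auto
  have tr_f: "trace V (f ^^ i) = (\<Sum>a<N. of_nat (dim (P a ` V)) * z ^ (a * i))" if "i < N" for i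
  proof -
    have "trace V (f ^^ i) = trace V (\<lambda>x. \<Sum>a<N. scale (z ^ (a * i)) (P a x))"
      by (intro arg_cong2[where f = trace] HOL.refl ext) (simp add: expand that)
    also have "\<dots> = (\<Sum>a<N. trace V (\<lambda>x. scale (z ^ (a * i)) (P a x)))"
      by (rule trace_sum[OF V]) (use linP PV in \<open>auto intro: subspace_scale[OF V]\<close>)
    also have "\<dots> = (\<Sum>a<N. of_nat (dim (P a ` V)) * z ^ (a * i))"
      using linP PV by (intro sum.cong HOL.refl) (subst trace_scale[OF V], auto simp: trP)
    finally show ?thesis .
  qed
  have "(\<Sum>a<N. of_nat (dim (P a ` V)) * z ^ a) = 1"
  proof (cases "N = 1")
    case True
    then have "trace V f = trace V (f ^^ 0)"
      using f by (intro trace_cong V) (auto simp: id_def)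
    then show ?thesis using tr tr_f[of 0] True by simp
  next
    case False
    then show ?thesis using tr tr_f[of 1] \<open>N > 0\<close> by simp
  qed
  then have "(\<Sum>a<N. of_nat (dim (P a ` V)) * z ^ (a * (N - 1))) = 1"
    by (rule rational_sum_of_roots_of_unity_inverse[OF z(1) \<open>N > 0\<close>])
  then show ?thesis using tr_f[of "N - 1"] \<open>N > 0\<close> by simp
qed

text \<open>
  If \<open>e\<close> is idempotent and \<open>p\<close> is an involution of its image, \<open>(e + p)/2\<close> and \<open>(e - p)/2\<close> are the
  projections onto the two eigenspaces of \<open>p\<close>. In particular \<open>tr p\<close> is an integer.
\<close>

lemma trace_involution:
  assumes e: "lin e" and p: "lin p" and id: "\<And>x. e (e x) = e x" "\<And>x. e (p x) = p x"
    "\<And>x. p (e x) = p x" "\<And>x. p (p x) = e x"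
  shows "\<exists>m n. trace UNIV p = of_nat m - of_nat n \<and> trace UNIV e = of_nat m + of_nat n \<and>
    m = dim (range (\<lambda>x. scale (1/2) (e x + p x))) \<and>
    n = dim (range (\<lambda>x. scale (1/2) (e x - p x)))"
proof -
  have two: "(2 :: 'a) \<noteq> 0" by simp
  let ?P = "\<lambda>x. scale (1/2) (e x + p x)" and ?M = "\<lambda>x. scale (1/2) (e x - p x)"
  have twice: "scale (1/2) (y + y) = y" for y
    using two scale_left_distrib[of "1/2" "1/2" y] by (simp add: scale_right_distrib)
  have P: "e (?P x) = ?P x" "p (?P x) = ?P x" for x
    using e p by (simp_all add: lin_add lin_scale id add.commute)
  have M: "e (?M x) = ?M x" "p (?M x) = - ?M x" for x
    using e p by (simp_all add: lin_diff lin_scale id scale_right_diff_distrib)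
  have "trace UNIV ?P = of_nat (dim (range ?P))"
    by (rule trace_idempotent) (use e p in \<open>simp_all only: P twice lin_scale_left lin_plus
      subspace_UNIV subset_UNIV\<close>)
  moreover have "trace UNIV ?M = of_nat (dim (range ?M))"
    by (rule trace_idempotent) (use e p in \<open>simp_all only: M diff_minus_eq_add twice lin_scale_left
      lin_minus subspace_UNIV subset_UNIV\<close>)
  moreover have "trace UNIV ?P = (trace UNIV e + trace UNIV p) / 2"
    using e p by (simp add: trace_scale trace_add del: scale_right_distrib)
  moreover have "trace UNIV ?M = (trace UNIV e - trace UNIV p) / 2"
    using e p by (simp add: trace_scale trace_diff del: scale_right_diff_distrib)
  moreover have "trace UNIV p = (trace UNIV e + trace UNIV p) / 2 - (trace UNIV e - trace UNIV p) / 2"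
    "trace UNIV e = (trace UNIV e + trace UNIV p) / 2 + (trace UNIV e - trace UNIV p) / 2"
    by (simp_all add: field_simps)
  ultimately show ?thesis by metis
qed

text \<open>
  The iterates of \<open>v\<close> satisfy a polynomial relation; linear factors are removed from it until one of
  them annihilates a nonzero vector.
\<close>

lemma eigenvector_exists:
  assumes V: "subspace V" and f: "lin f" "f ` V \<subseteq> V" and v: "v \<in> V" "v \<noteq> 0"
  obtains c w where "w \<in> V" "w \<noteq> 0" "f w = scale c w"
proof -
  have step: "\<exists>c w. w \<in> V \<and> w \<noteq> 0 \<and> f w = scale c w"
    if "v \<in> V" "v \<noteq> 0" "p \<noteq> 0" "degree p < n" "(\<Sum>i<n. scale (coeff p i) ((f ^^ i) v)) = 0"
    for n p v
    using that
  proof (induction n arbitrary: p v)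
    case (Suc m)
    show ?case
    proof (cases "degree p = 0")
      case True
      then have p0: "coeff p i = 0" if "i > 0" for i using that by (simp add: coeff_eq_0)
      have "coeff p 0 \<noteq> 0" using True Suc.prems(3) by (metis leading_coeff_0_iff)
      moreover have "scale (coeff p 0) v = 0"
        using Suc.prems(5) by (simp add: sum.lessThan_Suc_shift p0 del: sum.lessThan_Suc)
      ultimately show ?thesis using Suc.prems(2) by simp
    next
      case False
      then obtain c where "poly p c = 0" using alg_closed_imp_poly_has_root[of p] by auto
      then obtain r where r: "p = [:- c, 1:] * r" by (auto simp: poly_eq_0_iff_dvd dvd_def)
      have "r \<noteq> 0" using r Suc.prems(3) by auto
      then have dr: "degree r < m" using r Suc.prems(4) by (simp add: degree_mult_eq del: mult_pCons_left)
      have cp: "coeff p i = coeff (pCons 0 r) i - c * coeff r i" for i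
        by (simp add: r)
      let ?w = "f v - scale c v"
      have "(\<Sum>i<Suc m. scale (coeff p i) ((f ^^ i) v)) =
          (\<Sum>i<Suc m. scale (coeff (pCons 0 r) i) ((f ^^ i) v)) -
          (\<Sum>i<Suc m. scale (c * coeff r i) ((f ^^ i) v))"
        by (simp only: cp scale_left_diff_distrib sum_subtractf)
      also have "(\<Sum>i<Suc m. scale (coeff (pCons 0 r) i) ((f ^^ i) v)) =
          (\<Sum>i<m. scale (coeff r i) ((f ^^ i) (f v)))"
        by (simp add: sum.lessThan_Suc_shift funpow_swap1 del: sum.lessThan_Suc)
      also have "(\<Sum>i<Suc m. scale (c * coeff r i) ((f ^^ i) v)) =
          (\<Sum>i<m. scale (coeff r i) ((f ^^ i) (scale c v)))"
        using dr by (simp add: coeff_eq_0 lin_scale[OF lin_funpow[OF f(1)]] mult.commute)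
      finally have "(\<Sum>i<m. scale (coeff r i) ((f ^^ i) ?w)) = 0"
        using Suc.prems(5)
        by (simp add: lin_diff[OF lin_funpow[OF f(1)]] scale_right_diff_distrib sum_subtractf)
      moreover have "?w \<in> V" using Suc.prems(1) f V by (auto intro: subspace_diff subspace_scale)
      ultimately show ?thesis
      proof (cases "?w = 0")
        case True
        then show ?thesis using Suc.prems by auto
      qed (use Suc.IH[of ?w r] \<open>r \<noteq> 0\<close> dr in blast)
    qed
  qed simp
  obtain E where "finite_dimensional_vector_space scale E" using finite_dim by blast
  then interpret fd: finite_dimensional_vector_space scale E .
  let ?n = "Suc fd.dimension"
  have "\<exists>u. (\<exists>i<?n. u i \<noteq> 0) \<and> (\<Sum>i<?n. scale (u i) ((f ^^ i) v)) = 0"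
  proof (cases "inj_on (\<lambda>i. (f ^^ i) v) {..<?n}")
    case True
    let ?S = "(\<lambda>i. (f ^^ i) v) ` {..<?n}"
    have "card ?S = ?n" using True by (simp add: card_image)
    then have "dependent ?S"
      using fd.dim_subset_UNIV[of ?S] dim_eq_card_independent[of ?S] by (metis not_less_eq_eq order_refl)
    then obtain u w where "w \<in> ?S" "u w \<noteq> 0" "(\<Sum>v\<in>?S. scale (u v) v) = 0"
      by (auto simp: dependent_finite)
    with True show ?thesis
      by (intro exI[of _ "\<lambda>i. u ((f ^^ i) v)"]) (auto simp: sum.reindex)
  next
    case False
    then obtain i j where ij: "i < ?n" "j < ?n" "i \<noteq> j" "(f ^^ i) v = (f ^^ j) v"
      by (auto simp: inj_on_def)
    define u :: "nat \<Rightarrow> 'a" where "u k = (if k = i then 1 else 0) - (if k = j then 1 else 0)" for k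
    have "scale (u k) x = (if k = i then x else 0) - (if k = j then x else 0)" for k x
      by (simp add: u_def)
    then have "(\<Sum>k<?n. scale (u k) ((f ^^ k) v)) = 0"
      using ij by (simp add: sum_subtractf del: sum.lessThan_Suc)
    moreover have "u i \<noteq> 0" using ij by (simp add: u_def)
    ultimately show ?thesis using ij(1) by blast
  qed
  then obtain u i where u: "i < ?n" "u i \<noteq> 0" "(\<Sum>i<?n. scale (u i) ((f ^^ i) v)) = 0" by blast
  let ?p = "\<Sum>i<?n. monom (u i) i"
  have cp: "coeff ?p j = (if j < ?n then u j else 0)" for j
    by (simp add: coeff_sum del: sum.lessThan_Suc)
  have "?p \<noteq> 0" using cp[of i] u by (metis coeff_0)
  moreover have "degree ?p < ?n"
    by (rule degree_lessI) (use cp in \<open>auto simp del: sum.lessThan_Suc\<close>)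
  moreover have "(\<Sum>i<?n. scale (coeff ?p i) ((f ^^ i) v)) = 0"
    using u(3) by (simp add: cp del: sum.lessThan_Suc)
  ultimately show thesis using step[of v ?p ?n] v that by blast
qed

end

section \<open>Sweedler calculus\<close>

text \<open>
  The universal property of the threefold tensor product. It allows coassociativity to be used
  inside arbitrary trilinear expressions.
\<close>

lemma tensor3_lift:
  fixes f :: "'h::ab_group_add \<Rightarrow> 'h \<Rightarrow> 'h \<Rightarrow> 'a::ab_group_add"
  assumes add1: "\<And>a a' b c. f (a + a') b c = f a b c + f a' b c"
    and add2: "\<And>a b b' c. f a (b + b') c = f a b c + f a b' c"
    and add3: "\<And>a b c c'. f a b (c + c') = f a b c + f a b c'"
    and balanced12: "\<And>r a b c. f (scale r a) b c = f a (scale r b) c"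
    and balanced23: "\<And>r a b c. f a (scale r b) c = f a b (scale r c)"
    and eq: "formal_sum_eq (tensor3_rel scale) xs ys"
  shows "(\<Sum>(a, b, c)\<leftarrow>xs. f a b c) = (\<Sum>(a, b, c)\<leftarrow>ys. f a b c)"
  using eq
proof induction
  case (gen xs ys)
  have "f 0 b c = 0" for b c using add1[of 0 0 b c] by simp
  with gen show ?case
    by cases (auto simp: add1 add2 add3 balanced12 balanced23)
qed (auto simp: add_ac)

locale fin_dim_hopf_algebra = hopf_algebra scale comult counit antipode + fin_dim_space scale
  for scale :: "'k::field \<Rightarrow> 'h::ring_1 \<Rightarrow> 'h" and comult counit antipode
begin

lemma lin_antipode [simp]: "lin f \<Longrightarrow> lin (\<lambda>x. antipode (f x))"
  by (rule lin_comp[OF linear_antipode])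

lemma functional_counit [simp]: "lin f \<Longrightarrow> functional (\<lambda>x. counit (f x))"
  by (rule functional_comp[OF linear_counit])

lemma lin_mult_left [simp]: "lin f \<Longrightarrow> lin (\<lambda>x. a * f x)"
  by (simp add: lin_iff distrib_left scale_mult_right)

lemma lin_mult_right [simp]: "lin f \<Longrightarrow> lin (\<lambda>x. f x * a)"
  by (simp add: lin_iff distrib_right scale_mult_left)

lemmas scale_mult = scale_mult_left scale_mult_right

lemmas antipode_linear = lin_add[OF linear_antipode] lin_scale[OF linear_antipode]
  lin_zero[OF linear_antipode] lin_diff[OF linear_antipode]

lemmas counit_linear = functional_add[OF linear_counit] functional_scale[OF linear_counit]
  functional_zero[OF linear_counit] functional_diff[OF linear_counit]

text \<open>
  \<open>sw F h\<close> is \<open>\<Sum> F h\<^sub>1 h\<^sub>2\<close>. Iterated comultiplications are nested: \<open>\<Sum> F h\<^sub>1 h\<^sub>2 h\<^sub>3\<close> is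
  \<open>sw (\<lambda>a r. sw (\<lambda>b c. F a b c) r) h\<close>, and \<open>sw_assoc\<close> rewrites to this right-nested form.
\<close>

definition sw :: "('h \<Rightarrow> 'h \<Rightarrow> 'c::comm_monoid_add) \<Rightarrow> 'h \<Rightarrow> 'c" where
  "sw F h = (\<Sum>(a, b)\<leftarrow>sweedler comult h. F a b)"

definition bilin :: "('h \<Rightarrow> 'h \<Rightarrow> 'h) \<Rightarrow> bool" where
  "bilin F \<longleftrightarrow> (\<forall>a. lin (F a)) \<and> (\<forall>b. lin (\<lambda>a. F a b))"

lemma bilinI [simp]: "(\<And>a. lin (F a)) \<Longrightarrow> (\<And>b. lin (\<lambda>a. F a b)) \<Longrightarrow> bilin F"
  by (simp add: bilin_def)

lemma sw_tensor:
  assumes "comult h = tensor2 scale xs" "bilin F"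
  shows "sw F h = (\<Sum>(a, b)\<leftarrow>xs. F a b)"
proof -
  have "formal_sum_eq (tensor2_rel scale) (sweedler comult h) xs"
    using assms(1) comult_eq[of h] by (simp add: formal_sum_class_eq_iff)
  then show ?thesis
    unfolding sw_def
    by (rule tensor2_lift[rotated 3]) (use assms(2) in \<open>auto simp: bilin_def lin_iff\<close>)
qed

lemma sw_add: "bilin F \<Longrightarrow> sw F (g + h) = sw F g + sw F h"
  by (subst sw_tensor[OF comult_add]) (simp_all add: sw_def)

lemma sw_scale:
  assumes "bilin F"
  shows "sw F (scale c h) = scale c (sw F h)"
proof -
  have "sw F (scale c h) = (\<Sum>(a, b)\<leftarrow>sweedler comult h. scale c (F a b))"
    using assms
    by (subst sw_tensor[OF comult_scale]) (auto simp: comp_def case_prod_unfold bilin_def lin_iff)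
  also have "\<dots> = scale c (sw F h)"
    by (simp add: sw_def lin_sum_list[OF lin_scale_left[OF lin_ident]] comp_def case_prod_unfold)
  finally show ?thesis .
qed

lemma lin_sw [simp]: "bilin F \<Longrightarrow> lin f \<Longrightarrow> lin (\<lambda>x. sw F (f x))"
  by (simp add: lin_iff sw_add sw_scale)

lemma lin_sw_parameter [simp]: "(\<And>a b. lin (F a b)) \<Longrightarrow> lin (\<lambda>x. sw (\<lambda>a b. F a b x) h)"
  by (simp add: sw_def case_prod_unfold)

lemma sw_cong: "(\<And>a b. F a b = G a b) \<Longrightarrow> sw F h = sw G h"
  by (simp add: sw_def)

lemma lin_sw_push: "lin f \<Longrightarrow> f (sw F h) = sw (\<lambda>a b. f (F a b)) h"
  by (simp add: sw_def lin_sum_list comp_def case_prod_unfold)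

lemma functional_sw_push: "functional f \<Longrightarrow> f (sw F h) = sw (\<lambda>a b. f (F a b)) h"
  by (simp add: sw_def functional_sum_list comp_def case_prod_unfold)

lemma scale_sw: "scale c (sw F h) = sw (\<lambda>a b. scale c (F a b)) h"
  by (rule lin_sw_push) simp

lemma scale_sw_left: "scale (sw F h) v = sw (\<lambda>a b. scale (F a b) v) h"
proof -
  have "scale (\<Sum>p\<leftarrow>xs. G p) v = (\<Sum>p\<leftarrow>xs. scale (G p) v)" for xs :: "('h \<times> 'h) list" and G
    by (induction xs) (simp_all add: scale_left_distrib)
  then show ?thesis by (simp add: sw_def case_prod_unfold)
qed

lemma mult_sw:
  fixes F :: "'h \<Rightarrow> 'h \<Rightarrow> 'h"
  shows "y * sw F h = sw (\<lambda>a b. y * F a b) h"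
  by (rule lin_sw_push) simp

lemma sw_mult_const:
  fixes F :: "'h \<Rightarrow> 'h \<Rightarrow> 'h"
  shows "sw F h * y = sw (\<lambda>a b. F a b * y) h"
  by (rule lin_sw_push[where f = "\<lambda>x. x * y"]) simp

lemma sw_sum: "(\<Sum>i\<in>I. sw (F i) h) = sw (\<lambda>a b. \<Sum>i\<in>I. F i a b) h"
proof -
  have "(\<Sum>i\<in>I. \<Sum>p\<leftarrow>xs. G i p) = (\<Sum>p\<leftarrow>xs. \<Sum>i\<in>I. G i p)"
    for xs :: "('h \<times> 'h) list" and G :: "_ \<Rightarrow> _ \<Rightarrow> 'a"
    by (induction xs) (simp_all add: sum.distrib)
  then show ?thesis by (simp add: sw_def case_prod_unfold)
qed

lemma sw_swap: "sw (\<lambda>a b. sw (\<lambda>c d. F a b c d) g) h = sw (\<lambda>c d. sw (\<lambda>a b. F a b c d) h) g"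
proof -
  have "(\<Sum>x\<leftarrow>xs. \<Sum>y\<leftarrow>ys. G x y) = (\<Sum>y\<leftarrow>ys. \<Sum>x\<leftarrow>xs. G x y)" for xs ys :: "('h \<times> 'h) list" and G :: "_ \<Rightarrow> _ \<Rightarrow> 'a"
    by (induction xs) (simp_all add: sum_list_addf)
  then show ?thesis by (simp add: sw_def case_prod_unfold)
qed

lemma sw_one: "bilin F \<Longrightarrow> sw F 1 = F 1 1"
  by (subst sw_tensor[OF comult_one]) simp_all

lemma sum_list_concat_map:
  "(\<Sum>x\<leftarrow>concat (map f xs). g x) = (\<Sum>x\<leftarrow>xs. \<Sum>y\<leftarrow>f x. g y)"
  for g :: "'x \<Rightarrow> 'c::comm_monoid_add"
  by (induction xs) simp_all

lemma sw_mult: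
  assumes "bilin F"
  shows "sw F (g * h) = sw (\<lambda>a b. sw (\<lambda>c d. F (a * c) (b * d)) h) g"
  by (subst sw_tensor[OF comult_mult assms])
    (simp add: sw_def sum_list_concat_map case_prod_unfold comp_def)

lemma sw_assoc:
  assumes "\<And>b c. lin (\<lambda>a. F a b c)" "\<And>a c. lin (\<lambda>b. F a b c)" "\<And>a b. lin (\<lambda>c. F a b c)"
  shows "sw (\<lambda>a c. sw (\<lambda>x y. F x y c) a) h = sw (\<lambda>a c. sw (\<lambda>x y. F a x y) c) h"
proof -
  let ?l = "[(x, y, b). (a, b) \<leftarrow> sweedler comult h, (x, y) \<leftarrow> sweedler comult a]"
  let ?r = "[(a, x, y). (a, b) \<leftarrow> sweedler comult h, (x, y) \<leftarrow> sweedler comult b]"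
  have "(\<Sum>(a, b, c)\<leftarrow>?l. F a b c) = (\<Sum>(a, b, c)\<leftarrow>?r. F a b c)"
    by (rule tensor3_lift[where scale = scale])
      (use assms coassoc[of h] in \<open>auto simp: lin_iff formal_sum_class_eq_iff\<close>)
  then show ?thesis
    by (simp add: sw_def sum_list_concat_map case_prod_unfold comp_def)
qed

lemma sw_counit_left:
  assumes "lin f"
  shows "sw (\<lambda>a b. scale (counit a) (f b)) h = f h"
proof -
  have "f (sw (\<lambda>a b. scale (counit a) b) h) = f h"
    unfolding sw_def by (simp add: counit_left)
  then show ?thesis using assms by (simp add: lin_sw_push lin_scale)
qed

lemma sw_counit_right:
  assumes "lin f"
  shows "sw (\<lambda>a b. scale (counit b) (f a)) h = f h"
proof -
  have "f (sw (\<lambda>a b. scale (counit b) a) h) = f h"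
    unfolding sw_def by (simp add: counit_right)
  then show ?thesis using assms by (simp add: lin_sw_push lin_scale)
qed

lemma sw_antipode_left: "sw (\<lambda>a b. antipode a * b) h = scale (counit h) 1"
  unfolding sw_def by (rule antipode_left)

lemma sw_antipode_right: "sw (\<lambda>a b. a * antipode b) h = scale (counit h) 1"
  unfolding sw_def by (rule antipode_right)

lemma sw_antipode_left_lin:
  assumes "lin f"
  shows "sw (\<lambda>a b. f (antipode a * b)) h = scale (counit h) (f 1)"
  using lin_sw_push[OF assms, of "\<lambda>a b. antipode a * b" h] assms by (simp add: sw_antipode_left lin_scale)

lemma sw_antipode_right_lin:
  assumes "lin f"
  shows "sw (\<lambda>a b. f (a * antipode b)) h = scale (counit h) (f 1)"
  using lin_sw_push[OF assms, of "\<lambda>a b. a * antipode b" h] assms by (simp add: sw_antipode_right lin_scale)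

lemma antipode_one: "antipode 1 = 1"
  using sw_antipode_left[of 1] by (simp add: sw_one counit_one)

text \<open>
  Both sides are obtained from \<open>\<Sum> S(g\<^sub>1 h\<^sub>1) g\<^sub>2 h\<^sub>2 S(h\<^sub>3) S(g\<^sub>3)\<close>, by cancelling either the last
  two or the first two factors of each coproduct.
\<close>

lemma antipode_mult: "antipode (g * h) = antipode h * antipode g"
proof -
  let ?T = "sw (\<lambda>g1 g'. sw (\<lambda>h1 h'. sw (\<lambda>g2 g3. sw (\<lambda>h2 h3.
    antipode (g1 * h1) * (g2 * h2) * (antipode h3 * antipode g3)) h') g') h) g"
  have "sw (\<lambda>g2 g3. sw (\<lambda>h2 h3. y * (g2 * h2) * (antipode h3 * antipode g3)) h) g =
      scale (counit h) (scale (counit g) y)" for y g h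
  proof -
    have "sw (\<lambda>h2 h3. y * (g2 * h2) * (antipode h3 * antipode g3)) h =
        scale (counit h) (y * (g2 * antipode g3))" for g2 g3
      using sw_antipode_right_lin[of "\<lambda>u. y * (g2 * u * antipode g3)" h] by (simp add: mult.assoc)
    then show ?thesis
      using sw_antipode_right_lin[of "\<lambda>u. scale (counit h) (y * u)" g]
      by (simp add: mult.assoc scale_left_commute)
  qed
  then have "?T = sw (\<lambda>g1 g'. sw (\<lambda>h1 h'. scale (counit h') (scale (counit g') (antipode (g1 * h1)))) h) g"
    by simp
  also have "\<dots> = antipode (g * h)"
  proof -
    have "sw (\<lambda>h1 h'. scale (counit h') (scale (counit g') (antipode (g1 * h1)))) h =
        scale (counit g') (antipode (g1 * h))" for g1 g'
      by (rule sw_counit_right) simp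
    then show ?thesis by (simp only: sw_counit_right[of "\<lambda>x. antipode (x * h)"] lin_antipode lin_mult_right lin_ident)
  qed
  finally have T1: "?T = antipode (g * h)" .
  let ?F = "\<lambda>g1 g2 g3 h1 h2 h3. antipode (g1 * h1) * (g2 * h2) * (antipode h3 * antipode g3)"
  have "?T = sw (\<lambda>g1 g'. sw (\<lambda>g2 g3. sw (\<lambda>h1 h'. sw (\<lambda>h2 h3. ?F g1 g2 g3 h1 h2 h3) h') h) g') g"
    by (rule sw_cong) (rule sw_swap)
  also have "\<dots> = sw (\<lambda>g1 g'. sw (\<lambda>g2 g3. sw (\<lambda>h' h3. sw (\<lambda>h1 h2. ?F g1 g2 g3 h1 h2 h3) h') h) g') g"
    by (simp add: sw_assoc)
  also have "\<dots> = sw (\<lambda>g' g3. sw (\<lambda>g1 g2. sw (\<lambda>h' h3. sw (\<lambda>h1 h2. ?F g1 g2 g3 h1 h2 h3) h') h) g') g"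
    by (rule sw_assoc [symmetric]) simp_all
  also have "\<dots> = sw (\<lambda>g' g3. sw (\<lambda>h' h3. sw (\<lambda>g1 g2. sw (\<lambda>h1 h2. ?F g1 g2 g3 h1 h2 h3) h') g') h) g"
    by (rule sw_cong) (rule sw_swap)
  also have "\<dots> = sw (\<lambda>g' g3. sw (\<lambda>h' h3. scale (counit (g' * h')) (antipode h3 * antipode g3)) h) g"
  proof -
    have "sw (\<lambda>g1 g2. sw (\<lambda>h1 h2. antipode (g1 * h1) * (g2 * h2) * y) h') g' = scale (counit (g' * h')) y"
      for g' h' y
      using sw_antipode_left_lin[of "\<lambda>u. u * y" "g' * h'"] by (simp add: sw_mult)
    then show ?thesis by simp
  qed
  also have "\<dots> = antipode h * antipode g"
  proof -
    have "sw (\<lambda>h' h3. scale (counit (g' * h')) (antipode h3 * y)) h = scale (counit g') (antipode h * y)" for g' y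
      using sw_counit_left[of "\<lambda>u. scale (counit g') (antipode u * y)" h]
      by (simp add: counit_mult mult.commute)
    then show ?thesis by (simp add: sw_counit_left)
  qed
  finally show ?thesis using T1 by simp
qed

text \<open>
  The antipode reverses comultiplication:
  \<open>S(h\<^sub>1)\<^sub>1 h\<^sub>2 S(h\<^sub>5) \<otimes> S(h\<^sub>1)\<^sub>2 h\<^sub>3 S(h\<^sub>4)\<close> collapses to \<open>S(h)\<^sub>1 \<otimes> S(h)\<^sub>2\<close> from the right
  and to \<open>S(h\<^sub>2) \<otimes> S(h\<^sub>1)\<close> from the left.
\<close>

lemma sw_antipode_anti:
  assumes "bilin F"
  shows "sw F (antipode h) = sw (\<lambda>a b. F (antipode b) (antipode a)) h"
proof -
  have [simp]: "lin f \<Longrightarrow> lin (\<lambda>x. F (f x) y)" "lin f \<Longrightarrow> lin (\<lambda>x. F y (f x))" for f y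
    using assms lin_comp[of "F y" f] lin_comp[of "\<lambda>x. F x y" f] by (auto simp: bilin_def)
  have Fs: "F (scale c x) y = scale c (F x y)" "F x (scale c y) = scale c (F x y)" for c x y
    using assms by (auto simp: bilin_def lin_iff)
  let ?G = "\<lambda>y y' a b c d. F (y * a * antipode d) (y' * b * antipode c)"
  let ?U = "sw (\<lambda>h1 r. sw (\<lambda>y y'. sw (\<lambda>a r. sw (\<lambda>b r. sw (\<lambda>c d. ?G y y' a b c d) r) r) r) (antipode h1)) h"
  have right: "sw (\<lambda>a r. sw (\<lambda>b r. sw (\<lambda>c d. ?G y y' a b c d) r) r) r = scale (counit r) (F y y')" for y y' r
  proof -
    have "sw (\<lambda>a r. sw (\<lambda>b r. sw (\<lambda>c d. ?G y y' a b c d) r) r) r =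
        sw (\<lambda>a r. sw (\<lambda>u d. sw (\<lambda>b c. ?G y y' a b c d) u) r) r"
      by (simp add: sw_assoc)
    also have "\<dots> = sw (\<lambda>a r. sw (\<lambda>u d. scale (counit u) (F (y * a * antipode d) y')) r) r"
      by (intro sw_cong)
        (use sw_antipode_right_lin[of "\<lambda>u. F x (y' * u)" for x] in \<open>simp add: mult.assoc\<close>)
    also have "\<dots> = sw (\<lambda>a r. F (y * a * antipode r) y') r"
      by (intro sw_cong sw_counit_left) simp
    also have "\<dots> = scale (counit r) (F y y')"
      using sw_antipode_right_lin[of "\<lambda>u. F (y * u) y'"] by (simp add: mult.assoc)
    finally show ?thesis .
  qed
  have "?U = sw (\<lambda>h1 r. scale (counit r) (sw F (antipode h1))) h"
    by (simp add: right scale_sw)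
  also have "\<dots> = sw F (antipode h)"
    by (rule sw_counit_right) (use assms in simp)
  finally have U: "?U = sw F (antipode h)" .
  \<comment> \<open>The sum over the coproduct of \<open>S(h\<^sub>1)\<close> is moved inside, and the five factors are regrouped.\<close>
  have swap: "sw (\<lambda>y y'. sw (\<lambda>a r. sw (\<lambda>b r. sw (\<lambda>c d. ?G y y' a b c d) r) r) r) s =
      sw (\<lambda>a r. sw (\<lambda>b r. sw (\<lambda>c d. sw (\<lambda>y y'. ?G y y' a b c d) s) r) r) r" for r s
    by (simp add: sw_swap[of _ _ s])
  have "?U = sw (\<lambda>h1 r. sw (\<lambda>a r. sw (\<lambda>b r. sw (\<lambda>c d. sw (\<lambda>y y'. ?G y y' a b c d) (antipode h1)) r) r) r) h"
    by (simp only: swap)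
  also have "\<dots> = sw (\<lambda>p r. sw (\<lambda>c d. sw (\<lambda>h1 q. sw (\<lambda>a b. sw (\<lambda>y y'. ?G y y' a b c d) (antipode h1)) q) p) r) h"
  proof -
    let ?H = "\<lambda>h1 a b c d. sw (\<lambda>y y'. ?G y y' a b c d) (antipode h1)"
    have "sw (\<lambda>a r. sw (\<lambda>b r. sw (\<lambda>c d. ?H h1 a b c d) r) r) r =
        sw (\<lambda>q s. sw (\<lambda>a b. sw (\<lambda>c d. ?H h1 a b c d) s) q) r" for h1 r
      by (rule sw_assoc [symmetric]) simp_all
    moreover have "sw (\<lambda>h1 r. sw (\<lambda>q s. sw (\<lambda>a b. sw (\<lambda>c d. ?H h1 a b c d) s) q) r) h =
        sw (\<lambda>p s. sw (\<lambda>h1 q. sw (\<lambda>a b. sw (\<lambda>c d. ?H h1 a b c d) s) q) p) h"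
      by (rule sw_assoc [symmetric]) simp_all
    moreover have "sw (\<lambda>h1 q. sw (\<lambda>a b. sw (\<lambda>c d. ?H h1 a b c d) s) q) p =
        sw (\<lambda>c d. sw (\<lambda>h1 q. sw (\<lambda>a b. ?H h1 a b c d) q) p) s" for p s
      by (subst sw_swap) (rule sw_swap)
    ultimately show ?thesis by simp
  qed
  also have "\<dots> = sw (\<lambda>p r. sw (\<lambda>c d. scale (counit p) (F (antipode d) (antipode c))) r) h"
  proof -
    have "sw (\<lambda>h1 q. sw (\<lambda>a b. sw (\<lambda>y y'. ?G y y' a b c d) (antipode h1)) q) p =
        sw (\<lambda>h1 q. sw (\<lambda>u v. F (u * antipode d) (v * antipode c)) (antipode h1 * q)) p" for c d p
      by (rule sw_cong) (subst sw_mult, simp, rule sw_swap)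
    moreover have "sw (\<lambda>h1 q. sw (\<lambda>u v. F (u * antipode d) (v * antipode c)) (antipode h1 * q)) p =
        scale (counit p) (F (antipode d) (antipode c))" for c d p
      by (subst sw_antipode_left_lin) (simp_all add: sw_one)
    ultimately show ?thesis by simp
  qed
  also have "\<dots> = sw (\<lambda>a b. F (antipode b) (antipode a)) h"
    by (simp add: sw_counit_left flip: scale_sw)
  finally show ?thesis using U by simp
qed

end

section \<open>Minimal left ideals\<close>

definition minimal_left_ideal :: "'h::ring_1 set \<Rightarrow> bool" where
  "minimal_left_ideal L \<longleftrightarrow>
     left_ideal L \<and> L \<noteq> {0} \<and> (\<forall>I. left_ideal I \<longrightarrow> I \<subseteq> L \<longrightarrow> I = {0} \<or> I = L)"

locale semisimple_hopf_algebra =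
  fin_dim_hopf_algebra scale comult counit antipode + fin_dim_space_closed scale
  for scale :: "'k::{alg_closed_field, field_char_0} \<Rightarrow> 'h::ring_1 \<Rightarrow> 'h"
    and comult counit antipode +
  assumes semisimple: "semisimple_ring TYPE('h)"
begin

abbreviation integral :: 'h ("\<Lambda>") where
  "\<Lambda> \<equiv> idempotent_integral scale counit"

lemma integral_left: "h * \<Lambda> = scale (counit h) \<Lambda>"
  and integral_right: "\<Lambda> * h = scale (counit h) \<Lambda>"
  and counit_integral: "counit \<Lambda> = 1"
proof -
  have "is_idempotent_integral scale counit \<Lambda>"
    unfolding idempotent_integral_def by (rule theI'[OF ex1_idempotent_integral[OF semisimple]])
  then show "h * \<Lambda> = scale (counit h) \<Lambda>" "\<Lambda> * h = scale (counit h) \<Lambda>" "counit \<Lambda> = 1"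
    by (simp_all add: is_idempotent_integral_def)
qed

lemma left_ideal_subspace: "left_ideal I \<Longrightarrow> subspace I"
proof -
  assume I: "left_ideal I"
  have "scale c x = scale c 1 * x" for c x by (simp add: scale_mult)
  then show "subspace I" using I unfolding left_ideal_def subspace_def by metis
qed

lemma left_ideal_mult: "left_ideal I \<Longrightarrow> x \<in> I \<Longrightarrow> h * x \<in> I"
  by (simp add: left_ideal_def)

lemma left_ideal_zero: "left_ideal I \<Longrightarrow> 0 \<in> I"
  by (simp add: left_ideal_def)

lemma left_ideal_kernel:
  assumes "left_ideal L" "lin T" "\<And>h x. x \<in> L \<Longrightarrow> T (h * x) = h * T x"
  shows "left_ideal {x \<in> L. T x = 0}"
  using assms by (auto simp: left_ideal_def lin_add lin_zero)

lemma left_ideal_image: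
  assumes "left_ideal L" "lin T" "\<And>h x. x \<in> L \<Longrightarrow> T (h * x) = h * T x"
  shows "left_ideal (T ` L)"
  unfolding left_ideal_def
proof (intro conjI ballI allI)
  show "0 \<in> T ` L" using assms by (auto simp: left_ideal_def lin_zero intro!: image_eqI[of _ _ 0])
next
  fix x y assume "x \<in> T ` L" "y \<in> T ` L"
  then show "x + y \<in> T ` L" using assms(1)
    by (auto simp: left_ideal_def lin_add[OF assms(2), symmetric])
next
  fix h x assume "x \<in> T ` L"
  then obtain u where "u \<in> L" "x = T u" by blast
  then show "h * x \<in> T ` L" using assms(1,3) by (metis image_eqI left_ideal_mult)
qed

lemma dim_less:
  assumes "subspace I" "subspace J" "I \<subset> J"
  shows "dim I < dim J"
proof -
  obtain E where "finite_dimensional_vector_space scale E" using finite_dim by blast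
  then interpret fd: finite_dimensional_vector_space scale E .
  have "dim I \<le> dim J" using assms by (intro fd.dim_subset) auto
  moreover have "dim I \<noteq> dim J" using fd.subspace_dim_equal[of I J] assms by auto
  ultimately show ?thesis by simp
qed

lemma dim_pos: "subspace I \<Longrightarrow> I \<noteq> {0} \<Longrightarrow> dim I > 0"
proof -
  assume I: "subspace I" "I \<noteq> {0}"
  then have "{0} \<subset> I" using subspace_0[of I] by blast
  then show "dim I > 0" using dim_less[of "{0}" I] I by simp
qed

text \<open>
  Left ideals are subspaces, so one of smallest dimension is minimal.
\<close>

lemma minimal_left_ideal_exists:
  fixes I :: "'h set"
  assumes "left_ideal I" "I \<noteq> {0}"
  obtains L where "minimal_left_ideal L" "L \<subseteq> I"
proof -
  let ?P = "\<lambda>J. left_ideal J \<and> J \<noteq> {0} \<and> J \<subseteq> I"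
  obtain L where L: "?P L" "\<And>J. ?P J \<Longrightarrow> dim L \<le> dim J"
    using ex_has_least_nat[of ?P I dim] assms by auto
  have "J = {0} \<or> J = L" if "left_ideal J" "J \<subseteq> L" for J
  proof (rule ccontr)
    assume *: "\<not> ?thesis"
    then have "dim J < dim L" using that L(1) by (intro dim_less left_ideal_subspace) auto
    moreover have "?P J" using that * L(1) by auto
    ultimately show False using L(2) by fastforce
  qed
  then show thesis using that[of L] L(1) by (auto simp: minimal_left_ideal_def)
qed

text \<open>
  Splitting off minimal left ideals one at a time, finitely many of them detect all of a left
  ideal.
\<close>

lemma faithful_minimal_left_ideals:
  fixes I :: "'h set"
  assumes "left_ideal I"
  shows "\<exists>\<L>. finite \<L> \<and> (\<forall>L\<in>\<L>. minimal_left_ideal L) \<and>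
    (\<forall>h. (\<forall>L\<in>\<L>. \<forall>v\<in>L. h * v = 0) \<longrightarrow> (\<forall>v\<in>I. h * v = 0))"
  using assms
proof (induction "dim I" arbitrary: I rule: less_induct)
  case less
  show ?case
  proof (cases "I = {0}")
    case False
    then obtain L where L: "minimal_left_ideal L" "L \<subseteq> I"
      using minimal_left_ideal_exists less.prems by blast
    then have Lid: "left_ideal L" "L \<noteq> {0}" by (auto simp: minimal_left_ideal_def)
    from semisimple [unfolded semisimple_ring_def, rule_format, OF Lid(1)]
    obtain J where J: "left_ideal J" "L \<inter> J = {0}" "{x + y |x y. x \<in> L \<and> y \<in> J} = UNIV"
      by blast
    have IJ: "left_ideal (I \<inter> J)" using less.prems J(1) by (auto simp: left_ideal_def)
    have "I \<inter> J \<noteq> I"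
    proof
      assume "I \<inter> J = I"
      then have "L \<inter> J = L" using L(2) by auto
      with J(2) Lid(2) show False by simp
    qed
    then have "dim (I \<inter> J) < dim I"
      using IJ less.prems by (intro dim_less left_ideal_subspace) auto
    then obtain \<L> where \<L>: "finite \<L>" "\<forall>L\<in>\<L>. minimal_left_ideal L"
      "\<And>h. (\<forall>L\<in>\<L>. \<forall>v\<in>L. h * v = 0) \<Longrightarrow> (\<forall>v\<in>I \<inter> J. h * v = 0)"
      using less.hyps[OF _ IJ] by blast
    have "\<forall>v\<in>I. h * v = 0" if h: "\<forall>L\<in>insert L \<L>. \<forall>v\<in>L. h * v = 0" for h
    proof
      fix v assume v: "v \<in> I"
      obtain x y where xy: "v = x + y" "x \<in> L" "y \<in> J" using J(3) by blast
      then have "y = v - x" by simp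
      then have "y \<in> I"
        using v xy(2) L(2) subspace_diff[OF left_ideal_subspace[OF less.prems]] by blast
      then have "h * y = 0" using \<L>(3)[of h] h xy(3) by auto
      then show "h * v = 0" using h xy by (simp add: distrib_left)
    qed
    then show ?thesis using L(1) \<L>(1,2) by (intro exI[of _ "insert L \<L>"]) auto
  qed (intro exI[of _ "{}"], simp)
qed

definition character :: "'h set \<Rightarrow> 'h \<Rightarrow> 'k" where
  "character L h = trace L (\<lambda>x. h * x)"

lemma minimal_subspace: "minimal_left_ideal L \<Longrightarrow> subspace L"
  by (simp add: minimal_left_ideal_def left_ideal_subspace)

lemma minimal_mult: "minimal_left_ideal L \<Longrightarrow> x \<in> L \<Longrightarrow> h * x \<in> L"
  by (simp add: minimal_left_ideal_def left_ideal_mult)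

lemma character_frame:
  assumes "minimal_left_ideal L" "frame L B k"
  shows "character L h = (\<Sum>b\<in>B. k b (h * b))"
  unfolding character_def
  using assms minimal_mult by (intro trace_eq minimal_subspace) auto

lemma character_one: "minimal_left_ideal L \<Longrightarrow> character L 1 = of_nat (dim L)"
  by (simp add: character_def trace_ident minimal_subspace)

lemma character_one_nonzero: "minimal_left_ideal L \<Longrightarrow> character L 1 \<noteq> 0"
  using dim_pos[OF minimal_subspace] by (simp add: character_one minimal_left_ideal_def)

lemma functional_character:
  assumes "minimal_left_ideal L"
  shows "functional (character L)"
proof -
  obtain B k where B: "frame L B k" using frame_exists[OF minimal_subspace[OF assms]] by blast
  have "character L = (\<lambda>h. \<Sum>b\<in>B. k b (h * b))" using character_frame[OF assms B] by auto
  then show ?thesis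
    by (simp add: functional_comp[OF frame_functional[OF B]])
qed

text \<open>A nonzero equivariant map between minimal left ideals is bijective.\<close>

lemma schur_characters:
  assumes L': "minimal_left_ideal L'" and L: "minimal_left_ideal L"
    and T: "lin T" "T ` L' \<subseteq> L" "\<And>h x. x \<in> L' \<Longrightarrow> T (h * x) = h * T x"
    and x: "x \<in> L'" "T x \<noteq> 0"
  shows "character L' = character L"
proof
  fix h
  note sub = minimal_subspace[OF L'] minimal_subspace[OF L]
  have li: "left_ideal L'" "left_ideal L" using L L' by (simp_all add: minimal_left_ideal_def)
  have "{x \<in> L'. T x = 0} = {0}"
    using left_ideal_kernel[OF li(1) T(1,3)] L' x by (auto simp: minimal_left_ideal_def)
  then have inj: "inj_on T L'"
    unfolding inj_on_def using subspace_diff[OF sub(1)] lin_diff[OF T(1)]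
    by (metis (mono_tags, lifting) eq_iff_diff_eq_0 mem_Collect_eq singletonD)
  have "T ` L' \<noteq> {0}" using x by auto
  then have im: "T ` L' = L"
    using left_ideal_image[OF li(1) T(1,3)] L T(2) unfolding minimal_left_ideal_def by blast
  interpret vp: vector_space_pair scale scale ..
  obtain g where g: "g ` UNIV \<subseteq> L'" "lin g" "\<And>v. v \<in> L' \<Longrightarrow> g (T v) = v"
    using vp.linear_exists_left_inverse_on[OF T(1) sub(1) inj] by blast
  have Tg: "T (g y) = y" if "y \<in> L" for y
    using that im g(3) by (metis imageE)
  have "trace L' (\<lambda>x. h * x) = trace L' (\<lambda>x. g (h * T x))"
    using g L' T(3) by (intro trace_cong sub) (auto simp: minimal_mult lin_comp[OF g(2)] lin_comp[OF T(1)]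
      simp flip: T(3))
  also have "\<dots> = trace L (\<lambda>y. h * T (g y))"
    by (rule trace_commute[OF sub, of "\<lambda>x. h * T x" g])
      (use g T L in \<open>auto simp: minimal_mult lin_comp[OF T(1)]\<close>)
  also have "\<dots> = trace L (\<lambda>y. h * y)"
    using Tg g T L by (intro trace_cong sub) (auto simp: minimal_mult lin_comp[OF g(2)] lin_comp[OF T(1)])
  finally show "character L' h = character L h" by (simp add: character_def)
qed

text \<open>
  Schur's lemma over an algebraically closed field: the eigenspace of an equivariant map is a left
  ideal.
\<close>

lemma schur_scalar:
  assumes L: "minimal_left_ideal L"
    and T: "lin T" "T ` L \<subseteq> L" "\<And>h x. x \<in> L \<Longrightarrow> T (h * x) = h * T x"
  obtains c where "\<And>x. x \<in> L \<Longrightarrow> T x = scale c x"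
proof -
  have li: "left_ideal L" "L \<noteq> {0}" using L by (simp_all add: minimal_left_ideal_def)
  obtain v where "v \<in> L" "v \<noteq> 0" using li left_ideal_zero by blast
  then obtain c w where w: "w \<in> L" "w \<noteq> 0" "T w = scale c w"
    using eigenvector_exists[OF minimal_subspace[OF L] T(1,2)] by blast
  let ?T = "\<lambda>x. T x - scale c x"
  have "left_ideal {x \<in> L. ?T x = 0}"
    using T by (intro left_ideal_kernel li) (simp_all add: right_diff_distrib scale_mult)
  moreover have "w \<in> {x \<in> L. ?T x = 0}" using w by simp
  ultimately have "{x \<in> L. ?T x = 0} = L"
    using L w(2) unfolding minimal_left_ideal_def by blast
  then show thesis using that[of c] by (metis (mono_tags, lifting) eq_iff_diff_eq_0 mem_Collect_eq)
qed

section \<open>The Casimir element of the integral\<close>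

lemma functional_comp_simp [simp]: "functional f \<Longrightarrow> functional (\<lambda>x. f (h * x))"
  by (rule functional_comp) simp_all

text \<open>
  Multiplying \<open>\<Lambda>\<close> by \<open>h\<^sub>1\<close> on the left only inserts \<open>\<epsilon> h\<^sub>1\<close>, while a factor \<open>S h\<^sub>2 h\<^sub>3\<close> cancels. So
  \<open>\<Sum> \<Lambda>\<^sub>1 \<otimes> S \<Lambda>\<^sub>2\<close> is a separability idempotent.
\<close>

lemma casimir_commute:
  assumes "bilin F"
  shows "sw (\<lambda>a b. F (h * a) (antipode b)) \<Lambda> = sw (\<lambda>a b. F a (antipode b * h)) \<Lambda>"
proof -
  have [simp]: "lin f \<Longrightarrow> lin (\<lambda>x. F (f x) y)" "lin f \<Longrightarrow> lin (\<lambda>x. F y (f x))" for f y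
    using assms lin_comp[of "F y" f] lin_comp[of "\<lambda>x. F x y" f] by (auto simp: bilin_def)
  have "sw (\<lambda>h1 h2. sw (\<lambda>a b. F a (antipode b * h2)) (h1 * \<Lambda>)) h =
      sw (\<lambda>h1 h2. scale (counit h1) (sw (\<lambda>a b. F a (antipode b * h2)) \<Lambda>)) h"
    by (simp add: integral_left sw_scale)
  also have "\<dots> = sw (\<lambda>a b. F a (antipode b * h)) \<Lambda>"
    by (rule sw_counit_left) simp
  finally have "sw (\<lambda>a b. F a (antipode b * h)) \<Lambda> =
      sw (\<lambda>h1 h2. sw (\<lambda>a b. F a (antipode b * h2)) (h1 * \<Lambda>)) h" ..
  also have "\<dots> = sw (\<lambda>h1 h2. sw (\<lambda>a b. sw (\<lambda>x y. F (x * a) (antipode b * antipode y * h2)) h1) \<Lambda>) h"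
    by (rule sw_cong) (subst sw_mult, simp, subst sw_swap, simp add: antipode_mult)
  also have "\<dots> = sw (\<lambda>a b. sw (\<lambda>h1 h2. sw (\<lambda>x y. F (x * a) (antipode b * antipode y * h2)) h1) h) \<Lambda>"
    by (rule sw_swap)
  also have "\<dots> = sw (\<lambda>a b. sw (\<lambda>x r. sw (\<lambda>y h2. F (x * a) (antipode b * antipode y * h2)) r) h) \<Lambda>"
    by (simp add: sw_assoc)
  also have "\<dots> = sw (\<lambda>a b. F (h * a) (antipode b)) \<Lambda>"
  proof (rule sw_cong)
    fix a b
    have "sw (\<lambda>y h2. F (x * a) (antipode b * antipode y * h2)) r =
        scale (counit r) (F (x * a) (antipode b))" for x r
      using sw_antipode_left_lin[of "\<lambda>u. F (x * a) (antipode b * u)" r] by (simp add: mult.assoc)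
    then show "sw (\<lambda>x r. sw (\<lambda>y h2. F (x * a) (antipode b * antipode y * h2)) r) h =
        F (h * a) (antipode b)"
      using sw_counit_right[of "\<lambda>u. F (u * a) (antipode b)" h] by simp
  qed
  finally show ?thesis ..
qed

text \<open>
  The mirror image of \<open>casimir_commute\<close>, with \<open>h\<^sub>2 S(h\<^sub>3)\<close> in place of \<open>S(h\<^sub>2) h\<^sub>3\<close>. Since the first
  tensor factor is now multiplied on the right, an additional \<open>S\<close> appears.
\<close>

lemma casimir_twist:
  assumes "bilin F"
  shows "sw (\<lambda>a b. F (a * h) (antipode b)) \<Lambda> =
    sw (\<lambda>a b. F a (antipode (antipode h) * antipode b)) \<Lambda>"
proof -
  have [simp]: "lin f \<Longrightarrow> lin (\<lambda>x. F (f x) y)" "lin f \<Longrightarrow> lin (\<lambda>x. F y (f x))" for f y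
    using assms lin_comp[of "F y" f] lin_comp[of "\<lambda>x. F x y" f] by (auto simp: bilin_def)
  have "sw (\<lambda>h1 h2. sw (\<lambda>a b. F a (antipode (b * antipode h2))) (\<Lambda> * h1)) h =
      sw (\<lambda>h1 h2. scale (counit h1) (sw (\<lambda>a b. F a (antipode (b * antipode h2))) \<Lambda>)) h"
    by (simp add: integral_right sw_scale)
  also have "\<dots> = sw (\<lambda>a b. F a (antipode (b * antipode h))) \<Lambda>"
    by (rule sw_counit_left) simp
  finally have "sw (\<lambda>a b. F a (antipode (antipode h) * antipode b)) \<Lambda> =
      sw (\<lambda>h1 h2. sw (\<lambda>a b. F a (antipode (b * antipode h2))) (\<Lambda> * h1)) h"
    by (simp add: antipode_mult)
  also have "\<dots> = sw (\<lambda>h1 h2. sw (\<lambda>a b. sw (\<lambda>x y. F (a * x) (antipode (b * y * antipode h2))) h1) \<Lambda>) h"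
    by (rule sw_cong) (subst sw_mult, simp_all)
  also have "\<dots> = sw (\<lambda>a b. sw (\<lambda>h1 h2. sw (\<lambda>x y. F (a * x) (antipode (b * y * antipode h2))) h1) h) \<Lambda>"
    by (rule sw_swap)
  also have "\<dots> = sw (\<lambda>a b. sw (\<lambda>x r. sw (\<lambda>y h2. F (a * x) (antipode (b * y * antipode h2))) r) h) \<Lambda>"
    by (simp add: sw_assoc)
  also have "\<dots> = sw (\<lambda>a b. F (a * h) (antipode b)) \<Lambda>"
  proof (rule sw_cong)
    fix a b
    have "sw (\<lambda>y h2. F (a * x) (antipode (b * y * antipode h2))) r =
        scale (counit r) (F (a * x) (antipode b))" for x r
      using sw_antipode_right_lin[of "\<lambda>u. F (a * x) (antipode (b * u))" r] by (simp add: mult.assoc)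
    then show "sw (\<lambda>x r. sw (\<lambda>y h2. F (a * x) (antipode (b * y * antipode h2))) r) h =
        F (a * h) (antipode b)"
      using sw_counit_right[of "\<lambda>u. F (a * u) (antipode b)" h] by simp
  qed
  finally show ?thesis ..
qed

definition conjugator :: 'h where
  "conjugator = sw (\<lambda>a b. antipode b * a) \<Lambda>"

lemma conjugator_conjugation: "conjugator * h = antipode (antipode h) * conjugator"
  using casimir_twist[of "\<lambda>x y. y * x" h]
  by (simp add: conjugator_def mult_sw sw_mult_const mult.assoc)

lemma casimir_one: "sw (\<lambda>a b. a * antipode b) \<Lambda> = 1"
  by (simp add: sw_antipode_right counit_integral)

lemma casimir_square_antipode: "sw (\<lambda>a b. antipode b * antipode (antipode a)) \<Lambda> = 1"
  using sw_antipode_left_lin[of antipode \<Lambda>] lin_antipode[OF lin_ident]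
  by (simp add: antipode_mult counit_integral antipode_one)

lemma casimir_equivariant:
  assumes "functional f"
  shows "sw (\<lambda>a b. scale (f (antipode b * (h * x))) (a * v)) \<Lambda> =
    h * sw (\<lambda>a b. scale (f (antipode b * x)) (a * v)) \<Lambda>"
proof -
  have "bilin (\<lambda>a b. scale (f (b * x)) (a * v))"
    using functional_comp[OF assms lin_mult_right[OF lin_ident]] by simp
  from casimir_commute[OF this, of h] show ?thesis
    by (simp add: mult.assoc mult_sw scale_mult)
qed

text \<open>The Casimir element acts on a minimal left ideal through this multiple of \<open>conjugator\<close>.\<close>

definition pivot :: "('h \<Rightarrow> 'k) \<Rightarrow> 'h" where
  "pivot \<chi> = scale (1 / \<chi> 1) conjugator"

lemma casimir_maps_into:
  assumes "subspace L" "\<And>h x. x \<in> L \<Longrightarrow> h * x \<in> L" "v \<in> L"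
  shows "sw (\<lambda>a b. scale (f a b) (a * v)) h \<in> L"
proof -
  have "(\<Sum>p\<leftarrow>xs. scale (f (fst p) (snd p)) (fst p * v)) \<in> L" for xs
    using assms by (induction xs) (auto intro: subspace_0 subspace_add subspace_scale)
  then show ?thesis by (simp add: sw_def case_prod_unfold)
qed

text \<open>
  The left-hand side is equivariant in \<open>x\<close>, hence a scalar multiple of \<open>x\<close>. Taking the trace
  identifies the scalar.
\<close>

lemma casimir_schur:
  assumes L: "minimal_left_ideal L" and f: "functional f" and "v \<in> L" "x \<in> L"
  shows "sw (\<lambda>a b. scale (f (antipode b * x)) (a * v)) \<Lambda> = scale (f (pivot (character L) * v)) x"
proof -
  note sub = minimal_subspace[OF L]
  let ?T = "\<lambda>x. sw (\<lambda>a b. scale (f (antipode b * x)) (a * v)) \<Lambda>"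
  have linT: "lin ?T" using f by simp
  have TL: "?T ` L \<subseteq> L"
    using casimir_maps_into[OF sub minimal_mult[OF L] \<open>v \<in> L\<close>] by auto
  obtain c where c: "\<And>x. x \<in> L \<Longrightarrow> ?T x = scale c x"
    using schur_scalar[OF L linT TL] casimir_equivariant[OF f] by blast
  obtain B k where B: "frame L B k" using frame_exists[OF sub] by blast
  have "trace L ?T = trace L (\<lambda>x. scale c x)"
    by (rule trace_cong[OF sub linT _ TL c]) simp_all
  also have "\<dots> = c * character L 1"
    using trace_scale[OF sub lin_ident, of c] by (simp add: character_def)
  finally have tr: "trace L ?T = c * character L 1" .
  have "trace L ?T = (\<Sum>b\<in>B. k b (?T b))" by (rule trace_eq[OF sub linT TL B])
  also have "\<dots> = sw (\<lambda>a b. f (antipode b * (\<Sum>b\<in>B. scale (k b (a * v)) b))) \<Lambda>"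
    by (simp add: functional_sw_push[OF frame_functional[OF B]] functional_scale[OF frame_functional[OF B]]
        sw_sum sum_distrib_left scale_mult functional_sum[OF f] functional_scale[OF f] mult.commute
        flip: sum_distrib_right)
  also have "\<dots> = sw (\<lambda>a b. f (antipode b * (a * v))) \<Lambda>"
    using minimal_mult[OF L \<open>v \<in> L\<close>] by (simp add: frame_expand[OF B])
  also have "\<dots> = f (conjugator * v)"
    by (simp add: conjugator_def sw_mult_const functional_sw_push[OF f] mult.assoc)
  finally have "c * character L 1 = f (conjugator * v)" using tr by simp
  then have "c = f (pivot (character L) * v)"
    using character_one_nonzero[OF L]
    by (simp add: pivot_def scale_mult functional_scale[OF f] field_simps)
  then show ?thesis using c \<open>x \<in> L\<close> by simp
qed

text \<open>
  For different characters the same equivariant map is \<open>0\<close>. The character serves here as the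
  invariant of the isomorphism class of a minimal left ideal.
\<close>

lemma casimir_orthogonal:
  assumes L: "minimal_left_ideal L" and L': "minimal_left_ideal L'" and f: "functional f"
    and "v \<in> L" "x \<in> L'" and "character L' \<noteq> character L"
  shows "sw (\<lambda>a b. scale (f (antipode b * x)) (a * v)) \<Lambda> = 0"
proof (rule ccontr)
  let ?T = "\<lambda>x. sw (\<lambda>a b. scale (f (antipode b * x)) (a * v)) \<Lambda>"
  assume "?T x \<noteq> 0"
  have linT: "lin ?T" using f by simp
  have TL: "?T ` L' \<subseteq> L"
    using casimir_maps_into[OF minimal_subspace[OF L] minimal_mult[OF L] \<open>v \<in> L\<close>] by auto
  have "character L' = character L"
    by (rule schur_characters[OF L' L linT TL _ \<open>x \<in> L'\<close> \<open>?T x \<noteq> 0\<close>])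
      (rule casimir_equivariant[OF f])
  with assms show False by simp
qed

text \<open>
  Sum \<open>casimir_schur\<close> over a frame: the left-hand side becomes \<open>\<Sum> \<Lambda>\<^sub>1 S(\<Lambda>\<^sub>2) x = x\<close>.
\<close>

lemma character_pivot:
  assumes L: "minimal_left_ideal L"
  shows "character L (pivot (character L)) = 1"
proof -
  obtain B k where B: "frame L B k" using frame_exists[OF minimal_subspace[OF L]] by blast
  obtain x where x: "x \<in> L" "x \<noteq> 0"
    using L left_ideal_zero unfolding minimal_left_ideal_def by blast
  let ?Q = "pivot (character L)"
  have "x = sw (\<lambda>a b. a * (antipode b * x)) \<Lambda>"
    using sw_mult_const[of "\<lambda>a b. a * antipode b" \<Lambda> x] by (simp add: casimir_one mult.assoc)
  also have "\<dots> = sw (\<lambda>a b. a * (\<Sum>c\<in>B. scale (k c (antipode b * x)) c)) \<Lambda>"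
    using minimal_mult[OF L x(1)] by (simp add: frame_expand[OF B])
  also have "\<dots> = (\<Sum>c\<in>B. sw (\<lambda>a b. scale (k c (antipode b * x)) (a * c)) \<Lambda>)"
    by (simp add: sw_sum sum_distrib_left scale_mult)
  also have "\<dots> = (\<Sum>c\<in>B. scale (k c (?Q * c)) x)"
    using frame_subset[OF B] x(1) by (intro sum.cong HOL.refl casimir_schur[OF L frame_functional[OF B]]) auto
  also have "\<dots> = scale (character L ?Q) x"
    by (simp add: character_frame[OF L B] scale_sum_left)
  finally show ?thesis
    using x(2) by (metis scale_cancel_right scale_one)
qed

section \<open>The action of the elements \<open>z\<^sub>n\<close>\<close>

lemma functionals_separate:
  assumes "\<And>g. functional g \<Longrightarrow> g x = g y"
  shows "x = y"
proof -
  obtain B k where B: "frame UNIV B k" using frame_exists[OF subspace_UNIV] by blast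
  have "x = (\<Sum>b\<in>B. scale (k b x) b)" by (simp add: frame_expand[OF B])
  also have "\<dots> = (\<Sum>b\<in>B. scale (k b y) b)" by (simp add: assms[OF frame_functional[OF B]])
  also have "\<dots> = y" by (simp add: frame_expand[OF B])
  finally show ?thesis .
qed

text \<open>
  The terms of \<open>z\<^sub>n\<close> with the rank one operator \<open>f \<otimes> v\<close> inserted in the middle. The operator
  separates the two halves, so that one copy of \<open>\<Lambda>\<close> at a time can be evaluated by \<open>casimir_schur\<close>.
\<close>

definition z_sandwich :: "nat \<Rightarrow> 'h \<Rightarrow> ('h \<Rightarrow> 'k) \<Rightarrow> 'h \<Rightarrow> 'h" where
  "z_sandwich n v f x = (\<Sum>ps\<leftarrow>List.n_lists n (sweedler comult \<Lambda>).
     scale (f (prod_list (map (\<lambda>p. antipode (snd p)) ps) * x)) (prod_list (map fst ps) * v))"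

lemma z_sandwich_0: "z_sandwich 0 v f x = scale (f x) v"
  by (simp add: z_sandwich_def)

text \<open>
  Evaluating the outermost copy of \<open>\<Lambda>\<close> leaves a sum in which \<open>f\<close> is applied to the left half and the
  right half is the vector. Pairing with \<open>g\<close> interchanges the roles of the two functionals.
\<close>

lemma z_sandwich_Suc:
  assumes L: "minimal_left_ideal L" and f: "functional f" and g: "functional g"
    and "v \<in> L" "x \<in> L"
  shows "g (z_sandwich (Suc n) v f x) = f (pivot (character L) * z_sandwich n v g x)"
proof -
  let ?V = "\<lambda>ps. prod_list (map fst ps) :: 'h" and ?W = "\<lambda>ps. prod_list (map (\<lambda>p. antipode (snd p)) ps)"
  let ?ns = "List.n_lists n (sweedler comult \<Lambda>)" and ?Q = "pivot (character L)"
  have "z_sandwich (Suc n) v f x =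
      (\<Sum>ps\<leftarrow>?ns. sw (\<lambda>a b. scale (f (antipode b * (?W ps * x))) (a * (?V ps * v))) \<Lambda>)"
    by (simp add: z_sandwich_def sum_list_concat_map comp_def sw_def case_prod_unfold mult.assoc)
  also have "\<dots> = (\<Sum>ps\<leftarrow>?ns. scale (f (?Q * (?V ps * v))) (?W ps * x))"
    by (simp add: casimir_schur[OF L f] minimal_mult[OF L] assms)
  finally have "g (z_sandwich (Suc n) v f x) = (\<Sum>ps\<leftarrow>?ns. f (?Q * (?V ps * v)) * g (?W ps * x))"
    by (simp add: functional_sum_list[OF g] functional_scale[OF g] comp_def)
  also have "\<dots> = f (?Q * z_sandwich n v g x)"
    using functional_sum_list[OF functional_comp[OF f lin_mult_left[OF lin_ident]]]
    by (simp add: z_sandwich_def functional_scale[OF f] scale_mult comp_def mult.commute)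
  finally show ?thesis .
qed

lemma z_sandwich_Suc_Suc:
  assumes L: "minimal_left_ideal L" and f: "functional f" and v: "v \<in> L" and x: "x \<in> L"
  defines "Q \<equiv> pivot (character L)"
  shows "z_sandwich (Suc (Suc n)) v f x = Q * z_sandwich n v (\<lambda>y. f (Q * y)) x"
proof (rule functionals_separate)
  fix g :: "'h \<Rightarrow> 'k" assume g: "functional g"
  have fQ: "functional (\<lambda>y. f (Q * y))" using f by simp
  have "g (z_sandwich (Suc (Suc n)) v f x) = f (Q * z_sandwich (Suc n) v g x)"
    unfolding Q_def by (rule z_sandwich_Suc[OF L f g v x])
  also have "\<dots> = g (Q * z_sandwich n v (\<lambda>y. f (Q * y)) x)"
    unfolding Q_def by (rule z_sandwich_Suc[OF L g fQ[unfolded Q_def] v x])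
  finally show "g (z_sandwich (Suc (Suc n)) v f x) = g (Q * z_sandwich n v (\<lambda>y. f (Q * y)) x)" .
qed

lemma z_sandwich_even:
  assumes L: "minimal_left_ideal L" and f: "functional f" and v: "v \<in> L" and x: "x \<in> L"
  defines "Q \<equiv> pivot (character L)"
  shows "z_sandwich (2 * m) v f x = scale (f (Q ^ m * x)) (Q ^ m * v)"
  using f
proof (induction m arbitrary: f)
  case (Suc m)
  then have "functional (\<lambda>y. f (Q * y))" by simp
  from Suc.IH[OF this] z_sandwich_Suc_Suc[OF L Suc.prems v x] show ?case
    by (simp add: Q_def scale_mult mult.assoc)
qed (simp add: z_sandwich_0)

lemma z_sandwich_odd:
  assumes L: "minimal_left_ideal L" and f: "functional f" and v: "v \<in> L" and x: "x \<in> L"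
  defines "Q \<equiv> pivot (character L)"
  shows "z_sandwich (Suc (2 * m)) v f x = scale (f (Q ^ Suc m * v)) (Q ^ m * x)"
  using f
proof (induction m arbitrary: f)
  case 0
  show ?case
  proof (rule functionals_separate)
    fix g :: "'h \<Rightarrow> 'k" assume g: "functional g"
    show "g (z_sandwich (Suc (2 * 0)) v f x) = g (scale (f (Q ^ Suc 0 * v)) (Q ^ 0 * x))"
      using z_sandwich_Suc[OF L 0 g v x, of 0]
      by (simp add: z_sandwich_0 Q_def scale_mult functional_scale[OF g] functional_scale[OF 0])
  qed
next
  case (Suc m)
  then have "functional (\<lambda>y. f (Q * y))" by simp
  from Suc.IH[OF this] z_sandwich_Suc_Suc[OF L Suc.prems v x, of "Suc (2 * m)"] show ?case
    by (simp add: Q_def scale_mult mult.assoc)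
qed

abbreviation z :: "nat \<Rightarrow> 'h" where
  "z \<equiv> z_elem scale comult counit antipode"

text \<open>
  Summing over a frame replaces the rank one operators by the identity.
\<close>

lemma z_action:
  assumes L: "minimal_left_ideal L" and B: "frame L B k" and x: "x \<in> L"
  shows "z n * x = (\<Sum>b\<in>B. z_sandwich n b (k b) x)"
proof -
  let ?V = "\<lambda>ps. prod_list (map fst ps) :: 'h" and ?W = "\<lambda>ps. prod_list (map (\<lambda>p. antipode (snd p)) ps)"
  let ?ns = "List.n_lists n (sweedler comult \<Lambda>)"
  have swap: "(\<Sum>p\<leftarrow>ps. \<Sum>b\<in>B. F p b) = (\<Sum>b\<in>B. \<Sum>p\<leftarrow>ps. F p b)" for ps and F :: "('h \<times> 'h) list \<Rightarrow> 'h \<Rightarrow> 'h"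
    by (induction ps) (simp_all add: sum.distrib)
  have "z n * x = (\<Sum>ps\<leftarrow>?ns. ?V ps * (?W ps * x))"
    using lin_sum_list[OF lin_mult_right[OF lin_ident]]
    by (simp add: z_elem_def z_sum_def comp_def mult.assoc)
  also have "\<dots> = (\<Sum>ps\<leftarrow>?ns. ?V ps * (\<Sum>b\<in>B. scale (k b (?W ps * x)) b))"
    by (simp add: frame_expand[OF B] minimal_mult[OF L x])
  also have "\<dots> = (\<Sum>b\<in>B. z_sandwich n b (k b) x)"
    by (simp add: sum_distrib_left scale_mult swap z_sandwich_def)
  finally show ?thesis .
qed

lemma z_action_even:
  assumes L: "minimal_left_ideal L" and x: "x \<in> L"
  shows "z (2 * m) * x = pivot (character L) ^ (2 * m) * x"
proof -
  obtain B k where B: "frame L B k" using frame_exists[OF minimal_subspace[OF L]] by blast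
  let ?Q = "pivot (character L)"
  have "z (2 * m) * x = (\<Sum>b\<in>B. scale (k b (?Q ^ m * x)) (?Q ^ m * b))"
    unfolding z_action[OF L B x]
    using frame_subset[OF B] x by (intro sum.cong HOL.refl z_sandwich_even[OF L frame_functional[OF B]]) auto
  also have "\<dots> = ?Q ^ m * (\<Sum>b\<in>B. scale (k b (?Q ^ m * x)) b)"
    by (simp add: sum_distrib_left scale_mult)
  also have "\<dots> = ?Q ^ (2 * m) * x"
    using minimal_mult[OF L x]
    by (simp add: frame_expand[OF B] mult_2 power_add mult.assoc)
  finally show ?thesis .
qed

lemma z_action_odd:
  assumes L: "minimal_left_ideal L" and x: "x \<in> L"
  defines "Q \<equiv> pivot (character L)"
  shows "z (Suc (2 * m)) * x = scale (character L (Q ^ Suc m)) (Q ^ m * x)"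
proof -
  obtain B k where B: "frame L B k" using frame_exists[OF minimal_subspace[OF L]] by blast
  have "z (Suc (2 * m)) * x = (\<Sum>b\<in>B. scale (k b (Q ^ Suc m * b)) (Q ^ m * x))"
    unfolding z_action[OF L B x] Q_def
    using frame_subset[OF B] x by (intro sum.cong HOL.refl z_sandwich_odd[OF L frame_functional[OF B]]) auto
  then show ?thesis by (simp add: character_frame[OF L B] scale_sum_left)
qed

definition trivial_module :: "'h set" where
  "trivial_module = range (\<lambda>c. scale c \<Lambda>)"

lemma minimal_trivial_module: "minimal_left_ideal trivial_module"
  unfolding minimal_left_ideal_def
proof (intro conjI allI impI)
  have \<Lambda>: "\<Lambda> \<noteq> 0" using counit_integral counit_linear(3) by fastforce
  show "left_ideal trivial_module"
    by (auto simp: left_ideal_def trivial_module_def scale_mult integral_left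
        simp flip: scale_left_distrib intro: range_eqI[of _ _ 0])
  have "\<Lambda> \<in> trivial_module" by (auto simp: trivial_module_def intro: range_eqI[of _ _ 1])
  with \<Lambda> show "trivial_module \<noteq> {0}" by auto
  fix I :: "'h set" assume I: "left_ideal I" "I \<subseteq> trivial_module"
  show "I = {0} \<or> I = trivial_module"
  proof (cases "I = {0}")
    case False
    then obtain x where x: "x \<in> I" "x \<noteq> 0" using left_ideal_zero[OF I(1)] by blast
    then obtain c where c: "x = scale c \<Lambda>" using I(2) by (auto simp: trivial_module_def)
    then have "c \<noteq> 0" using x(2) by auto
    have "scale d \<Lambda> \<in> I" for d
      using subspace_scale[OF left_ideal_subspace[OF I(1)] x(1), of "d / c"] \<open>c \<noteq> 0\<close> c by simp
    then show ?thesis using I(2) by (auto simp: trivial_module_def)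
  qed simp
qed

lemma frame_trivial_module: "frame trivial_module {\<Lambda>} (\<lambda>_. counit)"
  using linear_counit
  by (auto simp: frame_def trivial_module_def counit_linear counit_integral intro: range_eqI[of _ _ 1])

lemma character_trivial_module: "character trivial_module = counit"
  using character_frame[OF minimal_trivial_module frame_trivial_module]
  by (auto simp: counit_mult counit_integral)

lemma counit_power: "counit (x ^ n) = counit x ^ n"
  by (induction n) (simp_all add: counit_one counit_mult)

text \<open>
  On the trivial module \<open>k \<Lambda>\<close> the pivot acts as its trace, \<open>1\<close>.
\<close>

lemma z_scalar_eq_one:
  assumes "z n = scale c 1"
  shows "c = 1"
proof -
  let ?Q = "pivot (character trivial_module)"
  have Q: "counit ?Q = 1"
    using character_pivot[OF minimal_trivial_module] by (simp add: character_trivial_module)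
  have \<Lambda>: "\<Lambda> \<in> trivial_module" by (auto simp: trivial_module_def intro: range_eqI[of _ _ 1])
  have "z n * \<Lambda> = \<Lambda>"
  proof (cases "even n")
    case True
    then obtain m where "n = 2 * m" by (auto elim: evenE)
    then show ?thesis
      using z_action_even[OF minimal_trivial_module \<Lambda>, of m] Q
      by (simp add: integral_left counit_power)
  next
    case False
    then obtain m where "n = Suc (2 * m)" by (metis oddE Suc_eq_plus1)
    then have "z n * \<Lambda> = scale (counit (?Q ^ Suc m)) (?Q ^ m * \<Lambda>)"
      by (simp only: z_action_odd[OF minimal_trivial_module \<Lambda>] character_trivial_module)
    also have "\<dots> = \<Lambda>"
      unfolding counit_power Q integral_left by simp
    finally show ?thesis .
  qed
  then have "scale c \<Lambda> = \<Lambda>" by (simp add: assms scale_mult)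
  then have "counit (scale c \<Lambda>) = counit \<Lambda>" by simp
  then show "c = 1" by (simp add: counit_linear counit_integral)
qed

text \<open>
  For \<open>n = 2 m + 1\<close> the operator \<open>Q\<^sup>m\<close> is the scalar \<open>1 / s\<close> with \<open>s = tr(Q\<^sup>m\<^sup>+\<^sup>1)\<close>. Inserting this
  into the trace and using \<open>tr Q = 1\<close> gives \<open>s\<^sup>2 = 1\<close>, so \<open>Q\<^sup>2\<^sup>m = 1\<close>.
\<close>

lemma pivot_finite_order:
  assumes z: "z n = scale c 1" and L: "minimal_left_ideal L" and x: "x \<in> L"
  shows "pivot (character L) ^ (2 * (n div 2)) * x = x"
proof -
  let ?Q = "pivot (character L)" and ?m = "n div 2"
  have zx: "z n * x = x" if "x \<in> L" for x
    using z z_scalar_eq_one[OF z] by simp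
  show ?thesis
  proof (cases "even n")
    case True
    then show ?thesis using z_action_even[OF L x, of ?m] zx[OF x] by simp
  next
    case False
    then have n: "n = Suc (2 * ?m)" by simp
    define s where "s = character L (?Q ^ Suc ?m)"
    have sx: "scale s (?Q ^ ?m * x) = x" if "x \<in> L" for x
      using z_action_odd[OF L that, of ?m] zx[OF that] n by (simp add: s_def)
    have "s * s = character L (scale s (?Q ^ Suc ?m))"
      by (simp add: functional_scale[OF functional_character[OF L]] s_def)
    also have "\<dots> = character L ?Q"
    proof -
      have "scale s (?Q ^ Suc ?m) * y = ?Q * y" if "y \<in> L" for y
      proof -
        have "scale s (?Q ^ Suc ?m) * y = ?Q * scale s (?Q ^ ?m * y)"
          by (simp add: scale_mult mult.assoc)
        then show ?thesis by (simp only: sx[OF that])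
      qed
      then have "trace L (\<lambda>y. scale s (?Q ^ Suc ?m) * y) = trace L (\<lambda>y. ?Q * y)"
        using minimal_mult[OF L] by (intro trace_cong[OF minimal_subspace[OF L]]) auto
      then show ?thesis by (simp only: character_def[of L])
    qed
    finally have ss: "s * s = 1" by (simp add: character_pivot[OF L])
    have "x = scale s (?Q ^ ?m * scale s (?Q ^ ?m * x))"
      using sx[OF x] by simp
    also have "\<dots> = scale (s * s) (?Q ^ (2 * ?m) * x)"
      by (simp add: scale_mult mult_2 power_add mult.assoc)
    finally show ?thesis by (simp add: ss)
  qed
qed

lemma character_pivot_inverse:
  assumes L: "minimal_left_ideal L" and "N > 0"
    and N: "\<And>x. x \<in> L \<Longrightarrow> pivot (character L) ^ N * x = x"
  shows "character L (pivot (character L) ^ (N - 1)) = 1"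
proof -
  let ?Q = "pivot (character L)"
  have pow: "(\<lambda>x. ?Q * x) ^^ j = (\<lambda>x. ?Q ^ j * x)" for j
    by (induction j) (auto simp: mult.assoc)
  show ?thesis
    using trace_inverse_of_finite_order[OF minimal_subspace[OF L], of "\<lambda>x. ?Q * x" N]
      \<open>N > 0\<close> N minimal_mult[OF L] character_pivot[OF L]
    by (auto simp: pow character_def)
qed

end

section \<open>The trace integral\<close>

text \<open>
  The information that a scalar \<open>z\<^sub>n\<close> provides: the pivots have a common finite order.
\<close>

locale hopf_algebra_finite_order_pivots = semisimple_hopf_algebra scale comult counit antipode
  for scale :: "'k::{alg_closed_field, field_char_0} \<Rightarrow> 'h::ring_1 \<Rightarrow> 'h"
    and comult counit antipode +
  fixes N :: nat
  assumes N_pos: "N > 0"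
    and pivot_order: "\<And>L x. minimal_left_ideal L \<Longrightarrow> x \<in> L \<Longrightarrow> pivot (character L) ^ N * x = x"
begin

abbreviation sq :: "'h \<Rightarrow> 'h" where
  "sq x \<equiv> antipode (antipode x)"

lemma sq_mult: "sq (x * y) = sq x * sq y"
  by (simp add: antipode_mult)

lemma sq_sw: "bilin F \<Longrightarrow> sw F (sq h) = sw (\<lambda>a b. F (sq a) (sq b)) h"
proof -
  assume F: "bilin F"
  then have "bilin (\<lambda>a b. F (antipode b) (antipode a))"
    using lin_comp[of "F y" antipode for y] lin_comp[of "\<lambda>x. F x y" antipode for y] linear_antipode
    by (auto simp: bilin_def)
  with F show ?thesis by (simp add: sw_antipode_anti)
qed

text \<open>
  By \<open>q h = S\<^sup>2(h) q\<close> the annihilator of \<open>q\<close> on the right is a left ideal. It contains no minimal left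
  ideal, because \<open>q\<close> acts on each of them as an operator of finite order up to a nonzero factor.
\<close>

lemma conjugator_cancel:
  assumes "conjugator * y = 0"
  shows "y = 0"
proof (rule ccontr)
  assume "y \<noteq> 0"
  let ?I = "range (\<lambda>h. h * y)"
  have "left_ideal ?I"
    by (auto simp: left_ideal_def image_iff simp flip: distrib_right mult.assoc intro: exI[of _ 0])
  moreover have "?I \<noteq> {0}" using \<open>y \<noteq> 0\<close> by (metis mult_1 rangeI singletonD)
  ultimately obtain L where L: "minimal_left_ideal L" "L \<subseteq> ?I"
    using minimal_left_ideal_exists by blast
  obtain x where x: "x \<in> L" "x \<noteq> 0"
    using L(1) left_ideal_zero unfolding minimal_left_ideal_def by blast
  then obtain h where "x = h * y" using L(2) by blast
  then have "conjugator * x = 0"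
    using assms by (metis conjugator_conjugation mult.assoc mult_zero_right)
  then have "pivot (character L) ^ N * x = 0"
    using N_pos by (cases N) (simp_all add: pivot_def power_Suc2 scale_mult mult.assoc del: power_Suc)
  then show False using pivot_order[OF L(1) x(1)] x(2) by simp
qed

lemma conjugator_invertible:
  obtains w where "conjugator * w = 1" "w * conjugator = 1"
proof -
  obtain E where "finite_dimensional_vector_space scale E" using finite_dim by blast
  then interpret fd: finite_dimensional_vector_space scale E .
  have "inj (\<lambda>x. conjugator * x)"
    using conjugator_cancel[of "x - y" for x y] by (auto simp: inj_def right_diff_distrib)
  then have "surj (\<lambda>x. conjugator * x)"
    by (intro fd.linear_inj_imp_surj) simp
  then obtain w where w: "conjugator * w = 1" by (metis surjD)
  have "conjugator * (w * conjugator - 1) = conjugator * w * conjugator - conjugator"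
    by (simp add: right_diff_distrib mult.assoc)
  then have "conjugator * (w * conjugator - 1) = 0" by (simp add: w)
  then have "w * conjugator = 1" using conjugator_cancel by fastforce
  with w show thesis using that by blast
qed

lemma sq_surj: "surj sq"
proof -
  obtain w where w: "conjugator * w = 1" "w * conjugator = 1" by (rule conjugator_invertible)
  have "sq (w * y * conjugator) = y" for y
  proof -
    have "sq (w * y * conjugator) = sq (w * y * conjugator) * (conjugator * w)" by (simp only: w mult_1_right)
    also have "\<dots> = conjugator * (w * y * conjugator) * w"
      by (subst mult.assoc [symmetric], subst conjugator_conjugation [symmetric], rule HOL.refl)
    also have "\<dots> = (conjugator * w) * y * (conjugator * w)" by (simp only: mult.assoc)
    finally show ?thesis by (simp only: w mult_1_left mult_1_right)
  qed
  then show ?thesis by (rule surjI)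
qed

lemma antipode_cancel:
  assumes "antipode x = antipode y"
  shows "x = y"
proof -
  have "conjugator * (x - y) = sq (x - y) * conjugator" by (rule conjugator_conjugation)
  also have "\<dots> = 0" using assms by (simp add: antipode_linear)
  finally show ?thesis using conjugator_cancel by fastforce
qed

text \<open>
  The sum of the irreducible characters, each twisted by the inverse of its pivot, is a Frobenius
  functional with dual bases \<open>\<Lambda>\<^sub>1\<close> and \<open>S \<Lambda>\<^sub>2\<close>. Its value at \<open>1\<close> is the number of characters,
  because the inverse pivots have trace \<open>1\<close>.
\<close>

lemma frobenius_functional_exists:
  obtains \<phi> r where "functional \<phi>" "\<phi> 1 = of_nat r" "r > 0"
    "\<And>x. sw (\<lambda>a b. scale (\<phi> (antipode b * x)) a) \<Lambda> = x"
proof -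
  have "left_ideal (UNIV :: 'h set)" by (simp add: left_ideal_def)
  from faithful_minimal_left_ideals[OF this] obtain \<L> :: "'h set set"
    where \<L>: "finite \<L>" "\<And>L. L \<in> \<L> \<Longrightarrow> minimal_left_ideal L"
      and faithful: "\<And>h. (\<And>L v. L \<in> \<L> \<Longrightarrow> v \<in> L \<Longrightarrow> h * v = 0) \<Longrightarrow> \<forall>v. h * v = 0"
    by auto
  have "\<L> \<noteq> {}"
  proof
    assume "\<L> = {}"
    then have "1 * (1 :: 'h) = 0" using faithful[of 1] by blast
    then show False by simp
  qed
  \<comment> \<open>Passing to the set of characters counts each isomorphism class once.\<close>
  define X where "X = character ` \<L>"
  have X: "finite X" "card X > 0" using \<L>(1) \<open>\<L> \<noteq> {}\<close> by (auto simp: X_def card_gt_0_iff)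
  define \<psi> where "\<psi> \<chi> h = \<chi> (pivot \<chi> ^ (N - 1) * h)" for \<chi> :: "'h \<Rightarrow> 'k" and h
  define \<phi> where "\<phi> h = (\<Sum>\<chi>\<in>X. \<psi> \<chi> h)" for h
  have fun\<psi>: "functional (\<psi> \<chi>)" if "\<chi> \<in> X" for \<chi>
    unfolding \<psi>_def [abs_def] using that \<L>(2)
    by (auto simp: X_def intro!: functional_comp_simp functional_character)
  then have fun\<phi>: "functional \<phi>" unfolding \<phi>_def [abs_def] by simp
  have "\<psi> \<chi> 1 = 1" if "\<chi> \<in> X" for \<chi>
    using that character_pivot_inverse[OF \<L>(2) N_pos] pivot_order \<L>(2) by (auto simp: X_def \<psi>_def)
  then have \<phi>1: "\<phi> 1 = of_nat (card X)" by (simp add: \<phi>_def)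
  have expand: "sw (\<lambda>a b. scale (\<psi> (character L) (antipode b)) (a * v)) \<Lambda> =
      (\<Sum>c\<in>B. sw (\<lambda>a b. scale (k c (pivot (character L) ^ (N - 1) * (antipode b * c))) (a * v)) \<Lambda>)"
    if "minimal_left_ideal L" "frame L B k" for L B k v
    by (simp add: \<psi>_def character_frame[OF that] sw_sum scale_sum_left mult.assoc)
  \<comment> \<open>The summand belonging to \<open>\<chi>\<close> is the projection onto the \<open>\<chi>\<close>-isotypic part.\<close>
  have orth: "sw (\<lambda>a b. scale (\<psi> \<chi> (antipode b)) (a * v)) \<Lambda> = (if \<chi> = character L then v else 0)"
    if "\<chi> \<in> X" and L: "minimal_left_ideal L" and v: "v \<in> L" for \<chi> L v
  proof (cases "\<chi> = character L")
    case True
    let ?Q = "pivot (character L)"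
    obtain B k where B: "frame L B k" using frame_exists[OF minimal_subspace[OF L]] by blast
    have "sw (\<lambda>a b. scale (\<psi> \<chi> (antipode b)) (a * v)) \<Lambda> =
        (\<Sum>c\<in>B. scale (k c (?Q ^ (N - 1) * (?Q * v))) c)"
      unfolding True expand[OF L B] using v frame_subset[OF B]
      by (intro sum.cong HOL.refl casimir_schur[OF L functional_comp_simp[OF frame_functional[OF B]]]) auto
    also have "\<dots> = ?Q ^ (N - 1) * (?Q * v)"
      by (intro frame_expand[OF B] minimal_mult[OF L] v)
    also have "\<dots> = ?Q ^ N * v"
      using N_pos by (metis Suc_pred' mult.assoc power_Suc2)
    finally show ?thesis using pivot_order[OF L v] True by simp
  next
    case False
    from that(1) obtain L' where L': "\<chi> = character L'" "minimal_left_ideal L'"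
      using \<L>(2) by (auto simp: X_def)
    obtain B k where B: "frame L' B k" using frame_exists[OF minimal_subspace[OF L'(2)]] by blast
    have "sw (\<lambda>a b. scale (\<psi> \<chi> (antipode b)) (a * v)) \<Lambda> = (\<Sum>c\<in>B. 0)"
      unfolding L'(1) expand[OF L'(2) B] using v frame_subset[OF B] False L'
      by (intro sum.cong HOL.refl casimir_orthogonal[OF L L'(2) functional_comp_simp[OF frame_functional[OF B]]]) auto
    then show ?thesis using False by simp
  qed
  let ?D = "sw (\<lambda>a b. scale (\<phi> (antipode b)) a) \<Lambda> - 1"
  have "?D * v = 0" if "L \<in> \<L>" "v \<in> L" for L v
  proof -
    have "sw (\<lambda>a b. scale (\<phi> (antipode b)) a) \<Lambda> * v =
        (\<Sum>\<chi>\<in>X. sw (\<lambda>a b. scale (\<psi> \<chi> (antipode b)) (a * v)) \<Lambda>)"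
      by (simp add: sw_mult_const \<phi>_def scale_sum_left sw_sum sum_distrib_right scale_mult)
    also have "\<dots> = (\<Sum>\<chi>\<in>X. if \<chi> = character L then v else 0)"
      using that \<L>(2) by (intro sum.cong HOL.refl orth) auto
    also have "\<dots> = v" using X(1) that(1) by (simp add: X_def)
    finally show ?thesis by (simp add: left_diff_distrib)
  qed
  then have "?D * 1 = 0" using faithful[of ?D] by blast
  then have one: "sw (\<lambda>a b. scale (\<phi> (antipode b)) a) \<Lambda> = 1" by simp
  have "sw (\<lambda>a b. scale (\<phi> (antipode b * x)) a) \<Lambda> = x" for x
  proof -
    have "sw (\<lambda>a b. scale (\<phi> (antipode b * x)) a) \<Lambda> = sw (\<lambda>a b. scale (\<phi> (antipode b)) (x * a)) \<Lambda>"
      by (rule casimir_commute [symmetric]) (use fun\<phi> in simp)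
    also have "\<dots> = x * sw (\<lambda>a b. scale (\<phi> (antipode b)) a) \<Lambda>"
      by (simp add: mult_sw scale_mult)
    finally show ?thesis by (simp add: one)
  qed
  then show thesis using that fun\<phi> \<phi>1 X(2) by blast
qed

definition trace_integral :: "'h \<Rightarrow> 'k" where
  "trace_integral h = trace UNIV (\<lambda>x. sq x * h)"

text \<open>
  Expanding \<open>f\<close> in the dual bases \<open>\<Lambda>\<^sub>1\<close> and \<open>S(\<Lambda>\<^sub>2)\<close> of the Frobenius functional \<open>\<phi>\<close> gives
  \<open>Tr f = \<Sum> \<phi>(S(\<Lambda>\<^sub>2) f(\<Lambda>\<^sub>1))\<close>. For \<open>f(x) = S\<^sup>2(x) h\<close> the right-hand side is \<open>\<phi>(h)\<close>, since
  \<open>\<Sum> S(\<Lambda>\<^sub>2) S\<^sup>2(\<Lambda>\<^sub>1) = 1\<close>.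
\<close>

lemma trace_integral_frobenius:
  shows functional_trace_integral: "functional trace_integral"
    and trace_integral_one: "\<exists>r>0. trace_integral 1 = of_nat r"
    and trace_integral_dual_bases: "sw (\<lambda>a b. scale (trace_integral (antipode b * x)) a) \<Lambda> = x"
proof -
  obtain \<phi> r where \<phi>: "functional \<phi>" "\<phi> 1 = of_nat r" "r > 0"
    "\<And>x. sw (\<lambda>a b. scale (\<phi> (antipode b * x)) a) \<Lambda> = x"
    by (rule frobenius_functional_exists) blast
  obtain B k where B: "frame UNIV B k" using frame_exists[OF subspace_UNIV] by blast
  have "trace UNIV f = sw (\<lambda>a b. \<phi> (antipode b * f a)) \<Lambda>" if f: "lin f" for f
  proof -
    have "trace UNIV f = (\<Sum>c\<in>B. k c (sw (\<lambda>a b. scale (\<phi> (antipode b * f c)) a) \<Lambda>))"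
      using trace_eq[OF subspace_UNIV f _ B] by (simp add: \<phi>(4))
    also have "\<dots> = sw (\<lambda>a b. \<Sum>c\<in>B. \<phi> (antipode b * f (scale (k c a) c))) \<Lambda>"
      by (simp add: functional_sw_push[OF frame_functional[OF B]] functional_scale[OF frame_functional[OF B]]
          functional_scale[OF \<phi>(1)] scale_mult sw_sum lin_scale[OF f] mult.commute)
    also have "\<dots> = sw (\<lambda>a b. \<phi> (antipode b * f (\<Sum>c\<in>B. scale (k c a) c))) \<Lambda>"
      by (simp add: lin_sum[OF f] sum_distrib_left functional_sum[OF \<phi>(1)])
    finally show ?thesis by (simp add: frame_expand[OF B])
  qed
  then have "trace_integral h = sw (\<lambda>a b. \<phi> (antipode b * (sq a * h))) \<Lambda>" for h
    by (simp add: trace_integral_def)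
  also have "\<dots> h = \<phi> (sw (\<lambda>a b. antipode b * sq a) \<Lambda> * h)" for h
    by (simp add: sw_mult_const functional_sw_push[OF \<phi>(1)] mult.assoc)
  finally have "trace_integral = \<phi>" by (auto simp: casimir_square_antipode)
  then show "functional trace_integral" "\<exists>r>0. trace_integral 1 = of_nat r"
    "sw (\<lambda>a b. scale (trace_integral (antipode b * x)) a) \<Lambda> = x"
    using \<phi> by auto
qed

lemma functional_ti [simp]: "lin f \<Longrightarrow> functional (\<lambda>x. trace_integral (f x))"
  by (rule functional_comp[OF functional_trace_integral])

lemmas trace_integral_linear = functional_add[OF functional_trace_integral]
  functional_scale[OF functional_trace_integral] functional_diff[OF functional_trace_integral]

text \<open>
  The trace of \<open>x \<mapsto> S\<^sup>2(x) a\<close> followed by right multiplication with \<open>b\<close> does not depend on the order of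
  the two.
\<close>

lemma trace_integral_cyclic: "trace_integral (a * b) = trace_integral (sq b * a)"
proof -
  have "trace UNIV (\<lambda>x. (\<lambda>x. sq x * a) x * b) = trace UNIV (\<lambda>y. sq (y * b) * a)"
    by (rule trace_commute) simp_all
  then show ?thesis by (simp add: trace_integral_def sq_mult mult.assoc)
qed

lemma trace_integral_nondegenerate:
  assumes "\<And>a. trace_integral (a * x) = 0"
  shows "x = 0"
proof -
  have "x = sw (\<lambda>a b. scale (trace_integral (antipode b * x)) a) \<Lambda>"
    by (simp add: trace_integral_dual_bases)
  also have "\<dots> = 0" by (simp add: assms sw_def case_prod_unfold)
  finally show ?thesis .
qed

text \<open>
  This is \<open>S\<^sup>2(b) h\<^sub>1 \<otimes> h\<^sub>2 = S\<^sup>2(b\<^sub>1) h\<^sub>1 \<otimes> S(b\<^sub>3) S\<^sup>2(b\<^sub>2) h\<^sub>2\<close>, with the first tensor factor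
  evaluated under \<open>k\<close>.
\<close>

lemma sw_sq_insert:
  assumes k: "functional k"
  shows "sw (\<lambda>a c. scale (k (sq b * a)) c) h =
    sw (\<lambda>b1 b2. sw (\<lambda>u v. scale (k u) (antipode b2 * v)) (sq b1 * h)) b"
proof -
  note [simp] = functional_comp[OF k]
  let ?F = "\<lambda>x y b2 a c. scale (k (sq x * a)) (antipode b2 * (sq y * c))"
  have "sw (\<lambda>u v. scale (k u) (antipode b2 * v)) (sq b1 * h) = sw (\<lambda>x y. sw (?F x y b2) h) b1"
    for b1 b2
    by (subst sw_mult, simp, subst sq_sw, simp_all)
  then have "sw (\<lambda>b1 b2. sw (\<lambda>u v. scale (k u) (antipode b2 * v)) (sq b1 * h)) b =
      sw (\<lambda>b1 b2. sw (\<lambda>x y. sw (?F x y b2) h) b1) b"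
    by simp
  also have "\<dots> = sw (\<lambda>x r. sw (\<lambda>y b2. sw (?F x y b2) h) r) b"
    by (rule sw_assoc) simp_all
  also have "\<dots> = sw (\<lambda>x r. scale (counit r) (sw (\<lambda>a c. scale (k (sq x * a)) c) h)) b"
  proof (rule sw_cong)
    fix x r
    have "sw (\<lambda>y b2. ?F x y b2 a c) r = scale (counit r) (scale (k (sq x * a)) c)" for a c
      using sw_antipode_left_lin[of "\<lambda>u. scale (k (sq x * a)) (antipode u * c)" r]
      by (simp add: antipode_mult antipode_one mult.assoc)
    then show "sw (\<lambda>y b2. sw (?F x y b2) h) r =
        scale (counit r) (sw (\<lambda>a c. scale (k (sq x * a)) c) h)"
      by (subst sw_swap) (simp add: scale_sw)
  qed
  also have "\<dots> = sw (\<lambda>a c. scale (k (sq b * a)) c) h"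
    by (rule sw_counit_right) simp
  finally show ?thesis ..
qed

text \<open>
  The left-hand side is a partial trace of \<open>b \<mapsto> S\<^sup>2(b) h\<^sub>1 \<otimes> h\<^sub>2\<close>. After \<open>sw_sq_insert\<close> this map
  is a composite that starts with the comultiplication of \<open>b\<close>. Cyclicity of the trace moves the
  comultiplication to the end, where the antipode cancels.
\<close>

lemma trace_integral_right_integral:
  "sw (\<lambda>a b. scale (trace_integral a) b) h = scale (trace_integral h) 1"
proof -
  obtain B k where B: "frame UNIV B k" using frame_exists[OF subspace_UNIV] by blast
  note kf = frame_functional[OF B]
  note [simp] = functional_comp[OF kf]
  have ti: "trace_integral y = (\<Sum>b\<in>B. k b (sq b * y))" for y
    unfolding trace_integral_def by (rule trace_eq[OF subspace_UNIV _ _ B]) simp_all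
  let ?P = "\<lambda>b y. sw (\<lambda>u v. scale (k b u) v) y"
  let ?R = "\<lambda>c x. sw (\<lambda>b1 b2. scale (k c (sq b1 * h)) (antipode b2)) x"
  have "sw (\<lambda>a b. scale (trace_integral a) b) h = (\<Sum>b\<in>B. sw (\<lambda>a c. scale (k b (sq b * a)) c) h)"
    by (simp add: ti scale_sum_left sw_sum)
  also have "\<dots> = (\<Sum>b\<in>B. sw (\<lambda>b1 b2. antipode b2 * ?P b (sq b1 * h)) b)"
    by (simp add: sw_sq_insert[OF kf] mult_sw scale_mult)
  also have "\<dots> = (\<Sum>b\<in>B. sw (\<lambda>b1 b2. antipode b2 * ?P b (\<Sum>c\<in>B. scale (k c (sq b1 * h)) c)) b)"
    by (simp add: frame_expand[OF B])
  also have "\<dots> = (\<Sum>b\<in>B. \<Sum>c\<in>B. ?R c b * ?P b c)"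
  proof (rule sum.cong[OF HOL.refl])
    fix b
    have "lin (?P b)" by simp
    then have "?P b (\<Sum>c\<in>B. scale (l c) c) = (\<Sum>c\<in>B. scale (l c) (?P b c))" for l
      by (simp add: lin_sum[of "?P b"] lin_scale[of "?P b"])
    then show "sw (\<lambda>b1 b2. antipode b2 * ?P b (\<Sum>c\<in>B. scale (k c (sq b1 * h)) c)) b =
        (\<Sum>c\<in>B. ?R c b * ?P b c)"
      by (simp add: sum_distrib_left scale_mult sw_mult_const sw_sum)
  qed
  also have "\<dots> = (\<Sum>c\<in>B. \<Sum>b\<in>B. ?R c b * ?P b c)" by (rule sum.swap)
  also have "\<dots> = (\<Sum>c\<in>B. scale (k c (sq c * h)) 1)"
  proof (rule sum.cong[OF HOL.refl])
    fix c
    have linR: "lin (?R c)" by simp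
    have "(\<Sum>b\<in>B. ?R c b * ?P b c) = sw (\<lambda>u v. ?R c (\<Sum>b\<in>B. scale (k b u) b) * v) c"
      by (simp add: mult_sw scale_mult sw_sum lin_sum[OF linR] lin_scale[OF linR] sum_distrib_right)
    also have "\<dots> = sw (\<lambda>u v. sw (\<lambda>b1 b2. scale (k c (sq b1 * h)) (antipode b2 * v)) u) c"
      by (simp add: frame_expand[OF B] sw_mult_const scale_mult)
    also have "\<dots> = sw (\<lambda>b1 r. sw (\<lambda>b2 v. scale (k c (sq b1 * h)) (antipode b2 * v)) r) c"
      by (rule sw_assoc) simp_all
    also have "\<dots> = sw (\<lambda>b1 r. scale (counit r) (scale (k c (sq b1 * h)) 1)) c"
      by (rule sw_cong) (rule sw_antipode_left_lin[of "\<lambda>u. scale a u" for a], simp)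
    also have "\<dots> = scale (k c (sq c * h)) 1"
      by (rule sw_counit_right) simp
    finally show "(\<Sum>b\<in>B. ?R c b * ?P b c) = scale (k c (sq c * h)) 1" .
  qed
  finally show ?thesis by (simp add: ti scale_sum_left)
qed

lemma trace_integral_one_nonzero: "trace_integral 1 \<noteq> 0"
  using trace_integral_one by auto

text \<open>
  Evaluate \<open>\<Sum> \<lambda>(h\<^sub>1) \<lambda>(S(h\<^sub>2))\<close> in two ways, with the integral property of \<open>\<lambda>\<close> and with the
  opposite one of \<open>\<lambda> \<circ> S\<close>, and divide by \<open>\<lambda>(1)\<close>.
\<close>

lemma trace_integral_antipode: "trace_integral (antipode h) = trace_integral h"
proof -
  have "antipode (sw (\<lambda>a b. scale (trace_integral (antipode b)) a) h) =
      sw (\<lambda>a b. scale (trace_integral a) b) (antipode h)"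
    by (subst sw_antipode_anti) (simp_all add: lin_sw_push[OF linear_antipode] antipode_linear)
  also have "\<dots> = antipode (scale (trace_integral (antipode h)) 1)"
    by (simp add: trace_integral_right_integral antipode_linear antipode_one)
  finally have "sw (\<lambda>a b. scale (trace_integral (antipode b)) a) h =
      scale (trace_integral (antipode h)) 1"
    by (rule antipode_cancel)
  from arg_cong[OF this, of trace_integral]
  have "sw (\<lambda>a b. trace_integral (antipode b) * trace_integral a) h =
      trace_integral (antipode h) * trace_integral 1"
    by (simp add: functional_sw_push[OF functional_trace_integral] trace_integral_linear)
  moreover from arg_cong[OF trace_integral_right_integral[of h], of "\<lambda>x. trace_integral (antipode x)"]
  have "sw (\<lambda>a b. trace_integral a * trace_integral (antipode b)) h =
      trace_integral h * trace_integral 1"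
    by (simp add: functional_sw_push[OF functional_comp[OF functional_trace_integral linear_antipode]]
        lin_sw_push[OF linear_antipode] functional_sw_push[OF functional_trace_integral]
        antipode_linear antipode_one trace_integral_linear)
  ultimately show ?thesis
    using trace_integral_one_nonzero by (simp add: mult.commute)
qed

text \<open>
  Cyclicity, applied to \<open>\<lambda>(b a) = \<lambda>(S(b a))\<close>, gives \<open>\<lambda>(b a) = \<lambda>(S\<^sup>4(b) a)\<close>; then use that \<open>\<lambda>\<close> is
  nondegenerate.
\<close>

lemma sq_sq: "sq (sq b) = b"
proof -
  have "trace_integral (y * (sq (sq b) - b)) = 0" for y
  proof -
    obtain a where a: "y = sq a" using sq_surj by (metis surjD)
    have "trace_integral (b * a) = trace_integral (antipode a * antipode b)"
      using trace_integral_antipode[of "b * a"] by (simp add: antipode_mult)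
    also have "\<dots> = trace_integral (antipode (a * sq b))"
      by (subst trace_integral_cyclic) (simp add: antipode_mult)
    also have "\<dots> = trace_integral (sq (sq b) * a)"
      by (simp only: trace_integral_antipode trace_integral_cyclic[of a])
    finally have "trace_integral ((sq (sq b) - b) * a) = 0"
      by (simp add: left_diff_distrib trace_integral_linear)
    then show ?thesis using a by (simp add: trace_integral_cyclic[of _ a])
  qed
  then show ?thesis using trace_integral_nondegenerate by fastforce
qed

section \<open>The character of the regular comodule\<close>

text \<open>
  The element \<open>x\<close> of \<open>H\<close> for which \<open>p x\<close> is the trace of \<open>h \<mapsto> \<Sum> p(h\<^sub>1) h\<^sub>2\<close>, for all functionals
  \<open>p\<close> on \<open>H\<close>. It is spelled out with a frame because it is a partial trace, with values in \<open>H\<close>.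
\<close>

definition regular_character :: 'h where
  "regular_character = (case (SOME (B, k). frame UNIV B k) of (B, k) \<Rightarrow>
     \<Sum>b\<in>B. sw (\<lambda>u v. scale (k b v) u) b)"

lemma regular_character_frame:
  obtains B k where "frame UNIV B k" "regular_character = (\<Sum>b\<in>B. sw (\<lambda>u v. scale (k b v) u) b)"
proof -
  obtain B k where Bk: "(SOME (B, k). frame UNIV B k) = (B, k)" by fastforce
  obtain C l where "frame UNIV C l" using frame_exists[OF subspace_UNIV] by blast
  then have "\<exists>p. case p of (B, k) \<Rightarrow> frame UNIV B k" by (intro exI[of _ "(C, l)"]) simp
  from someI_ex[OF this] have "frame UNIV B k" using Bk by simp
  then show thesis using that by (simp add: regular_character_def Bk)
qed

text \<open>
  As \<open>\<lambda>\<close> is an integral, the operator \<open>h \<mapsto> \<Sum> \<lambda>(h\<^sub>1) h\<^sub>2\<close> is \<open>h \<mapsto> \<lambda>(h) 1\<close>, whose trace is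
  \<open>\<lambda>(1)\<close>.
\<close>

lemma trace_integral_regular_character: "trace_integral regular_character = trace_integral 1"
proof -
  obtain B k where B: "frame UNIV B k"
    and reg: "regular_character = (\<Sum>b\<in>B. sw (\<lambda>u v. scale (k b v) u) b)"
    by (rule regular_character_frame)
  note kf = frame_functional[OF B]
  have "trace_integral regular_character = (\<Sum>b\<in>B. k b (sw (\<lambda>u v. scale (trace_integral u) v) b))"
    by (simp add: reg functional_sum[OF functional_trace_integral] functional_sw_push[OF kf]
        functional_sw_push[OF functional_trace_integral] functional_scale[OF kf]
        trace_integral_linear mult.commute)
  also have "\<dots> = trace_integral (\<Sum>b\<in>B. scale (k b 1) b)"
    by (simp add: trace_integral_right_integral functional_scale[OF kf] trace_integral_linear
        functional_sum[OF functional_trace_integral] mult.commute)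
  finally show ?thesis by (simp add: frame_expand[OF B])
qed

text \<open>
  The trace defining \<open>x\<close> is unchanged under conjugation by the coalgebra automorphism \<open>S\<^sup>2\<close>, which
  is its own inverse.
\<close>

lemma sq_regular_character: "sq regular_character = regular_character"
proof -
  obtain B k where B: "frame UNIV B k"
    and reg: "regular_character = (\<Sum>b\<in>B. sw (\<lambda>u v. scale (k b v) u) b)"
    by (rule regular_character_frame)
  note kf = frame_functional[OF B]
  note [simp] = functional_comp[OF kf]
  have linsq: "lin sq" by simp
  have "sq regular_character = (\<Sum>b\<in>B. sw (\<lambda>u v. scale (k b v) (sq u)) b)"
    by (simp add: reg lin_sum[OF linsq] lin_sw_push[OF linsq] lin_scale[OF linsq])
  also have "\<dots> = (\<Sum>b\<in>B. sw (\<lambda>u v. scale (k b (sq v)) u) (sq b))"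
    by (simp add: sq_sw sq_sq)
  also have "\<dots> = (\<Sum>b\<in>B. sw (\<lambda>u v. scale (k b (sq v)) u) (\<Sum>e\<in>B. scale (k e (sq b)) e))"
    by (simp add: frame_expand[OF B])
  also have "\<dots> = (\<Sum>b\<in>B. \<Sum>e\<in>B. scale (k e (sq b)) (sw (\<lambda>u v. scale (k b (sq v)) u) e))"
  proof (rule sum.cong[OF HOL.refl])
    fix b
    have "lin (sw (\<lambda>u v. scale (k b (sq v)) u))" using lin_sw[OF _ lin_ident] by simp
    then show "sw (\<lambda>u v. scale (k b (sq v)) u) (\<Sum>e\<in>B. scale (k e (sq b)) e) =
        (\<Sum>e\<in>B. scale (k e (sq b)) (sw (\<lambda>u v. scale (k b (sq v)) u) e))"
      by (simp only: lin_sum lin_scale)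
  qed
  also have "\<dots> = (\<Sum>e\<in>B. \<Sum>b\<in>B. scale (k e (sq b)) (sw (\<lambda>u v. scale (k b (sq v)) u) e))"
    by (rule sum.swap)
  also have "\<dots> = (\<Sum>e\<in>B. sw (\<lambda>u v. scale (k e (sq (\<Sum>b\<in>B. scale (k b (sq v)) b))) u) e)"
    by (simp add: scale_sw sw_sum scale_sum_left[symmetric] lin_sum[OF linsq] lin_scale[OF linsq]
        functional_sum[OF kf] functional_scale[OF kf] mult.commute)
  also have "\<dots> = regular_character"
    by (simp add: frame_expand[OF B] sq_sq reg)
  finally show ?thesis .
qed

lemma frame_UNIV_trace_ident:
  assumes "frame UNIV B k"
  shows "(\<Sum>b\<in>B. k b b) = of_nat (dim UNIV)"
  using trace_eq[OF subspace_UNIV lin_ident _ assms] trace_ident[OF subspace_UNIV] by simp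

text \<open>
  The tensor square of the regular comodule is free of rank \<open>dim H\<close>, through
  \<open>b \<otimes> c \<mapsto> b c\<^sub>1 \<otimes> c\<^sub>2\<close> with inverse \<open>b \<otimes> c \<mapsto> b S(c\<^sub>1) \<otimes> c\<^sub>2\<close>. Applied to a functional \<open>p\<close>, this
  compares the trace of \<open>T(x) = \<Sum> p(x\<^sub>1) x\<^sub>2\<close> on the tensor factors: \<open>inserted\<close> rewrites the coaction
  on \<open>b \<otimes> c\<close> through the isomorphism, \<open>cyc\<close> is cyclicity in the factor \<open>b\<close>, and the rest of the
  proof is cyclicity in the factor \<open>c\<close>.
\<close>

lemma regular_character_square:
  "regular_character * regular_character = scale (of_nat (dim UNIV)) regular_character"
proof (rule functionals_separate)
  fix p :: "'h \<Rightarrow> 'k" assume p: "functional p"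
  obtain B k where B: "frame UNIV B k"
    and reg: "regular_character = (\<Sum>b\<in>B. sw (\<lambda>u v. scale (k b v) u) b)"
    by (rule regular_character_frame)
  note kf = frame_functional[OF B]
  note [simp] = functional_comp[OF kf] functional_comp[OF p]
  let ?T = "\<lambda>x. sw (\<lambda>u v. scale (p u) v) x"
  define \<theta> where "\<theta> y = trace UNIV (\<lambda>x. ?T (x * y))" for y
  have tr: "trace UNIV f = (\<Sum>b\<in>B. k b (f b))" if "lin f" for f
    using trace_eq[OF subspace_UNIV that _ B] by simp
  have \<theta>: "\<theta> y = (\<Sum>b\<in>B. k b (?T (b * y)))" for y
    unfolding \<theta>_def by (rule tr) simp
  have fun\<theta>: "functional \<theta>" unfolding \<theta> [abs_def] by simp
  note [simp] = functional_comp[OF fun\<theta>]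
  have pT: "p (sw (\<lambda>u v. scale (k b v) (u * y)) b) = k b (sw (\<lambda>u v. scale (p (u * y)) v) b)" for b y
    by (simp add: functional_sw_push[OF p] functional_sw_push[OF kf] functional_scale[OF p]
        functional_scale[OF kf] mult.commute)
  have preg: "p regular_character = \<theta> 1"
    using pT[of _ 1] by (simp add: reg functional_sum[OF p] \<theta>)
  have inserted: "sw (\<lambda>c1 r. sw (\<lambda>c2 c3. scale (k b (?T (x * c1) * antipode c2)) c3) r) c =
      sw (\<lambda>c1 c2. scale (k b (sw (\<lambda>u v. scale (p (u * c1)) v) x)) c2) c" for b c x
  proof -
    let ?H = "\<lambda>s t c2 c3. sw (\<lambda>u v. scale (k b (scale (p (u * s)) (v * (t * antipode c2)))) c3) x"
    have "?T (x * c1) = sw (\<lambda>s t. sw (\<lambda>u v. scale (p (u * s)) (v * t)) x) c1" for c1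
      by (subst sw_mult, simp) (rule sw_swap)
    then have "scale (k b (?T (x * c1) * antipode c2)) c3 = sw (\<lambda>s t. ?H s t c2 c3) c1" for c1 c2 c3
      by (simp add: sw_mult_const functional_sw_push[OF kf] scale_sw_left scale_mult mult.assoc)
    then have "sw (\<lambda>c1 r. sw (\<lambda>c2 c3. scale (k b (?T (x * c1) * antipode c2)) c3) r) c =
        sw (\<lambda>c1 r. sw (\<lambda>c2 c3. sw (\<lambda>s t. ?H s t c2 c3) c1) r) c" by simp
    also have "\<dots> = sw (\<lambda>c1 r. sw (\<lambda>s t. sw (\<lambda>c2 c3. ?H s t c2 c3) r) c1) c"
      by (rule sw_cong) (rule sw_swap)
    also have "\<dots> = sw (\<lambda>s r. sw (\<lambda>t r. sw (\<lambda>c2 c3. ?H s t c2 c3) r) r) c"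
      by (rule sw_assoc) simp_all
    also have "\<dots> = sw (\<lambda>s r. sw (\<lambda>w c3. sw (\<lambda>t c2. ?H s t c2 c3) w) r) c"
      by (rule sw_cong) (rule sw_assoc [symmetric], simp_all)
    also have "\<dots> = sw (\<lambda>s c3. ?H s 1 1 c3) c"
    proof (rule sw_cong)
      fix s r
      have "sw (\<lambda>t c2. ?H s t c2 c3) w = scale (counit w) (?H s 1 1 c3)" for w c3
        using sw_antipode_right_lin
          [of "\<lambda>y. sw (\<lambda>u v. scale (k b (scale (p (u * s)) (v * y))) c3) x" w]
        by (simp add: antipode_one)
      then show "sw (\<lambda>w c3. sw (\<lambda>t c2. ?H s t c2 c3) w) r = ?H s 1 1 r"
        by (simp add: sw_counit_left)
    qed
    also have "\<dots> = sw (\<lambda>c1 c2. scale (k b (sw (\<lambda>u v. scale (p (u * c1)) v) x)) c2) c"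
      by (simp add: functional_sw_push[OF kf] scale_sw_left antipode_one)
    finally show ?thesis .
  qed
  have cyc: "(\<Sum>b\<in>B. k b (?T (b * c1) * antipode c2)) = \<theta> (antipode c2 * c1)" for c1 c2
  proof -
    have "trace UNIV (\<lambda>x. (\<lambda>x. ?T (x * c1)) x * antipode c2) =
        trace UNIV (\<lambda>y. ?T (y * antipode c2 * c1))"
      by (rule trace_commute) simp_all
    then show ?thesis unfolding \<theta>_def by (subst (asm) tr) (simp_all add: mult.assoc)
  qed
  \<comment> \<open>The operator whose trace is \<open>p (x * x)\<close>, where \<open>x\<close> is the regular character.\<close>
  let ?W = "\<lambda>c. sw (\<lambda>c1 r. sw (\<lambda>c2 c3. scale (\<theta> (antipode c2 * c1)) c3) r) c"
  have W: "sw (\<lambda>c1 c2. scale (p (regular_character * c1)) c2) c = ?W c" for c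
  proof -
    have "sw (\<lambda>c1 c2. scale (p (regular_character * c1)) c2) c =
        (\<Sum>b\<in>B. sw (\<lambda>c1 c2. scale (k b (sw (\<lambda>u v. scale (p (u * c1)) v) b)) c2) c)"
      by (simp add: reg sum_distrib_right functional_sum[OF p] sw_mult_const scale_mult pT
          scale_sum_left sw_sum)
    also have "\<dots> = (\<Sum>b\<in>B. sw (\<lambda>c1 r. sw (\<lambda>c2 c3. scale (k b (?T (b * c1) * antipode c2)) c3) r) c)"
      by (simp only: inserted)
    also have "\<dots> = ?W c"
      by (simp add: sw_sum scale_sum_left[symmetric] cyc)
    finally show ?thesis .
  qed
  have "p (regular_character * regular_character) = (\<Sum>c\<in>B. k c (?W c))"
  proof -
    have "p (regular_character * regular_character) =
        p (\<Sum>c\<in>B. regular_character * sw (\<lambda>u v. scale (k c v) u) c)"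
      by (subst (2) reg) (simp add: sum_distrib_left)
    also have "\<dots> = (\<Sum>c\<in>B. k c (sw (\<lambda>c1 c2. scale (p (regular_character * c1)) c2) c))"
      by (simp add: functional_sum[OF p] mult_sw scale_mult functional_sw_push[OF p]
          functional_scale[OF p] functional_sw_push[OF kf] functional_scale[OF kf] mult.commute)
    finally show ?thesis by (simp only: W)
  qed
  also have "\<dots> = (\<Sum>c\<in>B. \<Sum>f\<in>B. sw (\<lambda>c1 r. sw (\<lambda>c2 c3. k f r * \<theta> (antipode c2 * c1) * k c c3) f) c)"
  proof (rule sum.cong[OF HOL.refl])
    fix c
    have "sw (\<lambda>c2 c3. scale (\<theta> (antipode c2 * c1)) c3) r =
        (\<Sum>f\<in>B. scale (k f r) (sw (\<lambda>c2 c3. scale (\<theta> (antipode c2 * c1)) c3) f))" for c1 r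
    proof -
      have lin: "lin (\<lambda>r. sw (\<lambda>c2 c3. scale (\<theta> (antipode c2 * c1)) c3) r)" by simp
      have "sw (\<lambda>c2 c3. scale (\<theta> (antipode c2 * c1)) c3) (\<Sum>f\<in>B. scale (k f r) f) =
          (\<Sum>f\<in>B. scale (k f r) (sw (\<lambda>c2 c3. scale (\<theta> (antipode c2 * c1)) c3) f))"
        by (simp only: lin_sum[OF lin] lin_scale[OF lin])
      then show ?thesis by (simp add: frame_expand[OF B])
    qed
    then have "?W c = (\<Sum>f\<in>B. sw (\<lambda>c1 r. sw (\<lambda>c2 c3. scale (k f r * \<theta> (antipode c2 * c1)) c3) f) c)"
      by (simp add: sw_sum scale_sw)
    then show "k c (?W c) = (\<Sum>f\<in>B. sw (\<lambda>c1 r. sw (\<lambda>c2 c3. k f r * \<theta> (antipode c2 * c1) * k c c3) f) c)"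
      by (simp add: functional_sum[OF kf] functional_sw_push[OF kf] functional_scale[OF kf])
  qed
  also have "\<dots> = (\<Sum>f\<in>B. \<Sum>c\<in>B. sw (\<lambda>c2 c3. sw (\<lambda>c1 r. k f r * \<theta> (antipode c2 * c1) * k c c3) c) f)"
    by (subst sum.swap) (intro sum.cong HOL.refl sw_swap)
  also have "\<dots> = (\<Sum>f\<in>B. k f (scale (\<theta> 1) f))"
  proof (rule sum.cong[OF HOL.refl])
    fix f
    let ?Y = "\<lambda>c2 x. sw (\<lambda>c1 r. scale (\<theta> (antipode c2 * c1)) r) x"
    have Y: "(\<Sum>c\<in>B. scale (k c x) (?Y c2 c)) = ?Y c2 x" for c2 x
    proof -
      have lin: "lin (?Y c2)" by simp
      have "?Y c2 (\<Sum>c\<in>B. scale (k c x) c) = (\<Sum>c\<in>B. scale (k c x) (?Y c2 c))"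
        by (simp only: lin_sum[OF lin] lin_scale[OF lin])
      then show ?thesis by (simp add: frame_expand[OF B])
    qed
    have "(\<Sum>c\<in>B. sw (\<lambda>c2 c3. sw (\<lambda>c1 r. k f r * \<theta> (antipode c2 * c1) * k c c3) c) f) =
        k f (sw (\<lambda>c2 c3. \<Sum>c\<in>B. scale (k c c3) (?Y c2 c)) f)"
      by (simp add: sw_sum functional_sum[OF kf] functional_sw_push[OF kf] functional_scale[OF kf]
          scale_sw mult_ac)
    also have "\<dots> = k f (sw (\<lambda>c2 c3. sw (\<lambda>c1 r. scale (\<theta> (antipode c2 * c1)) r) c3) f)"
      by (simp only: Y)
    also have "sw (\<lambda>c2 c3. sw (\<lambda>c1 r. scale (\<theta> (antipode c2 * c1)) r) c3) f =
        sw (\<lambda>a r. sw (\<lambda>c2 c1. scale (\<theta> (antipode c2 * c1)) r) a) f"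
      by (rule sw_assoc [symmetric]) simp_all
    also have "\<dots> = sw (\<lambda>a r. scale (counit a) (scale (\<theta> 1) r)) f"
      by (rule sw_cong) (rule sw_antipode_left_lin, simp)
    also have "\<dots> = scale (\<theta> 1) f" by (rule sw_counit_left) simp
    finally show "(\<Sum>c\<in>B. sw (\<lambda>c2 c3. sw (\<lambda>c1 r. k f r * \<theta> (antipode c2 * c1) * k c c3) c) f) =
        k f (scale (\<theta> 1) f)" .
  qed
  also have "\<dots> = \<theta> 1 * of_nat (dim UNIV)"
    by (simp add: functional_scale[OF kf] frame_UNIV_trace_ident[OF B] flip: sum_distrib_left)
  finally show "p (regular_character * regular_character) =
      p (scale (of_nat (dim UNIV)) regular_character)"
    by (simp add: functional_scale[OF p] preg mult.commute)
qed

section \<open>The antipode is an involution\<close>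

lemma dim_UNIV_pos: "dim (UNIV :: 'h set) > 0"
proof (rule dim_pos[OF subspace_UNIV])
  show "(UNIV :: 'h set) \<noteq> {0}" by (metis UNIV_I singletonD zero_neq_one)
qed

text \<open>
  With \<open>E\<close> the projection \<open>h \<mapsto> h x / D\<close>, where \<open>x\<close> is the regular character, the trace of
  \<open>S\<^sup>2\<close> is \<open>D\<close> times that of \<open>E \<circ> S\<^sup>2\<close>. Both traces are integers, and the first is nonzero and at
  most \<open>D\<close> in absolute value, so \<open>S\<^sup>2\<close> has only one eigenvalue.
\<close>

lemma antipode_involution: "sq x = x"
proof -
  let ?D = "dim (UNIV :: 'h set)"
  have D: "(of_nat ?D :: 'k) \<noteq> 0" using dim_UNIV_pos by simp
  define E where "E x = scale (1 / of_nat ?D) (x * regular_character)" for x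
  have linE: "lin E" unfolding E_def [abs_def] by simp
  have linsq: "lin sq" by simp
  note [simp] = lin_comp[OF linE]
  have EE: "E (E x) = E x" for x
    using D by (simp add: E_def scale_mult mult.assoc regular_character_square)
  have Esq: "sq (E x) = E (sq x)" for x
    by (simp add: E_def antipode_linear sq_mult sq_regular_character)
  have tr_sq: "trace UNIV sq = of_nat ?D * trace UNIV (\<lambda>x. E (sq x))"
  proof -
    have "trace UNIV sq = trace_integral regular_character"
      by (simp add: trace_integral_regular_character) (simp add: trace_integral_def)
    also have "\<dots> = trace UNIV (\<lambda>x. scale (of_nat ?D) (E (sq x)))"
      using D by (simp add: trace_integral_def E_def)
    also have "\<dots> = of_nat ?D * trace UNIV (\<lambda>x. E (sq x))"
      by (rule trace_scale) simp_all
    finally show ?thesis .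
  qed
  obtain m n where mn: "trace UNIV sq = of_nat m - of_nat n" "(of_nat ?D :: 'k) = of_nat m + of_nat n"
    "m = dim (range (\<lambda>x. scale (1/2) (x + sq x)))" "n = dim (range (\<lambda>x. scale (1/2) (x - sq x)))"
    using trace_involution[OF lin_ident linsq] by (auto simp: sq_sq trace_ident)
  obtain m' n' where mn': "trace UNIV (\<lambda>x. E (sq x)) = of_nat m' - of_nat n'"
    using trace_involution[of E "\<lambda>x. E (sq x)"] by (auto simp: linE EE Esq sq_sq)
  have "of_int (int m - int n) = (of_int (int ?D * (int m' - int n')) :: 'k)"
    using tr_sq mn(1) mn' by simp
  then have eq: "int m - int n = int ?D * (int m' - int n')" by (simp only: of_int_eq_iff)
  have "(of_nat ?D :: 'k) = of_nat (m + n)" using mn(2) by simp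
  then have sum: "?D = m + n" by (simp only: of_nat_eq_iff)
  have "trace UNIV sq \<noteq> 0"
    using trace_integral_one_nonzero by (simp add: trace_integral_def)
  then have "m \<noteq> n" using mn(1) by auto
  then have "int m' - int n' \<noteq> 0" using eq by auto
  then have "\<bar>int m' - int n'\<bar> \<ge> 1" by linarith
  then have "\<bar>int m - int n\<bar> \<ge> int ?D"
    unfolding eq abs_mult using mult_left_mono[of 1 "\<bar>int m' - int n'\<bar>" "int ?D"] by simp
  then have "m = 0 \<or> n = 0" using sum by linarith
  moreover have range0: "f y = 0" if "dim (range f) = 0" "lin f" for f y
  proof (rule ccontr)
    assume "f y \<noteq> 0"
    have "subspace (range f)"
      using Vector_Spaces.linear.axioms(3)[OF that(2)] subspace_UNIV by (rule module_hom.subspace_image)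
    moreover have "range f \<noteq> {0}" using \<open>f y \<noteq> 0\<close> by (metis rangeI singletonD)
    ultimately show False using dim_pos[of "range f"] that(1) by simp
  qed
  moreover have "m \<noteq> 0"
  proof
    assume "m = 0"
    then have "scale (1/2) (1 + sq 1) = 0"
      using mn(3) range0[of "\<lambda>x. scale (1/2) (x + sq x)" 1] by simp
    moreover have "counit (scale (1/2) (1 + sq 1)) = 1"
      unfolding antipode_one counit_linear counit_one by simp
    ultimately show False by (simp only: counit_linear zero_neq_one)
  qed
  ultimately have "scale (1/2) (x - sq x) = 0"
    using mn(4) range0[of "\<lambda>x. scale (1/2) (x - sq x)" x] by simp
  then show ?thesis by simp
qed

text \<open>With \<open>S\<^sup>2 = id\<close> the pivots are scalars \<open>1 / d\<close>, and their finite order forces \<open>d = 1\<close>.\<close>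

lemma minimal_left_ideal_dim:
  assumes L: "minimal_left_ideal L"
  shows "dim L = 1"
proof -
  have "conjugator = 1"
    using casimir_square_antipode by (simp add: antipode_involution conjugator_def)
  then have Q: "pivot (character L) ^ N * x = scale (1 / of_nat (dim L) ^ N) x" for x
  proof -
    have "scale c 1 ^ j = scale (c ^ j) 1" for c j
      by (induction j) (simp_all add: scale_mult)
    then show ?thesis
      using \<open>conjugator = 1\<close> by (simp add: pivot_def character_one[OF L] scale_mult power_divide)
  qed
  obtain x where x: "x \<in> L" "x \<noteq> 0"
    using L left_ideal_zero unfolding minimal_left_ideal_def by blast
  have "scale (1 / of_nat (dim L) ^ N) x = scale 1 x"
    using pivot_order[OF L x(1)] Q[of x] by simp
  then have "1 / of_nat (dim L) ^ N = (1 :: 'k)" using x(2) by (metis scale_cancel_right)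
  then have "(of_nat (dim L ^ N) :: 'k) = of_nat 1" by (simp add: divide_eq_1_iff)
  then have "dim L ^ N = 1" by (simp only: of_nat_eq_iff)
  then show ?thesis using N_pos by (simp add: nat_power_eq_Suc_0_iff)
qed

text \<open>
  The minimal left ideals are one-dimensional, so commutators annihilate them, and they are jointly faithful.
\<close>

lemma mult_commute_of_pivots: "x * y = y * (x :: 'h)"
proof -
  have comm: "(x * y - y * x) * v = 0" if L: "minimal_left_ideal L" and v: "v \<in> L" for L v
  proof -
    obtain B k where B: "frame L B k" "card B = dim L"
      using frame_exists[OF minimal_subspace[OF L]] by metis
    then obtain b where "B = {b}" using minimal_left_ideal_dim[OF L] by (auto simp: card_1_singleton_iff)
    then have mb: "w = scale (k b w) b" if "w \<in> L" for w
      using frame_expand[OF B(1) that] by simp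
    have b: "b \<in> L" using frame_subset[OF B(1)] \<open>B = {b}\<close> by simp
    define c where "c h = k b (h * b)" for h
    have act: "h * b = scale (c h) b" for h
      using mb[OF minimal_mult[OF L b]] by (simp add: c_def)
    have act2: "x * y * b = scale (c y * c x) b" for x y
    proof -
      have "x * y * b = x * (y * b)" by (rule mult.assoc)
      then show ?thesis by (simp only: act scale_mult_right scale_scale)
    qed
    have "(x * y - y * x) * b = 0"
      by (simp add: left_diff_distrib act2 mult.commute)
    then have "(x * y - y * x) * scale (k b v) b = 0" by (simp only: scale_mult scale_zero_right)
    then show ?thesis by (simp only: mb[OF v, symmetric])
  qed
  have "left_ideal (UNIV :: 'h set)" by (simp add: left_ideal_def)
  from faithful_minimal_left_ideals[OF this] comm have "(x * y - y * x) * 1 = 0" by blast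
  then show ?thesis by simp
qed

end

section \<open>Commutativity and the elements \<open>z\<^sub>n\<close>\<close>

context semisimple_hopf_algebra
begin

lemma z_commutative:
  assumes comm: "\<And>x y :: 'h. x * y = y * x"
  shows "z n = 1"
proof -
  let ?xs = "sweedler comult \<Lambda>"
  have one: "(\<Sum>p\<leftarrow>?xs. fst p * antipode (snd p)) = 1"
    using casimir_one by (simp add: sw_def case_prod_unfold)
  have "(\<Sum>ps\<leftarrow>List.n_lists n ?xs. prod_list (map fst ps) * prod_list (map (\<lambda>p. antipode (snd p)) ps)) = 1"
  proof (induction n)
    case (Suc n)
    have "(\<Sum>p\<leftarrow>?xs. fst p * v * (antipode (snd p) * w)) = v * w" for v w
    proof -
      have "fst p * v * (antipode (snd p) * w) = fst p * antipode (snd p) * (v * w)" for p :: "'h \<times> 'h"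
        by (metis comm mult.assoc)
      then show ?thesis
        by (simp add: sum_list_mult_const one)
    qed
    then show ?case
      using Suc by (simp add: sum_list_concat_map comp_def)
  qed simp
  then show ?thesis by (simp add: z_elem_def z_sum_def)
qed

lemma commutative_of_z_scalar:
  assumes "n \<ge> 2" "z n \<in> range (\<lambda>c. scale c 1)"
  shows "x * y = y * (x :: 'h)"
proof -
  obtain c where c: "z n = scale c 1" using assms(2) by blast
  interpret hopf_algebra_finite_order_pivots scale comult counit antipode "2 * (n div 2)"
    by unfold_locales (use assms(1) pivot_finite_order[OF c] in auto)
  show ?thesis by (rule mult_commute_of_pivots)
qed

end

theorem theorem2p10:
  fixes scale :: "'k::{alg_closed_field, field_char_0} \<Rightarrow> 'h::ring_1 \<Rightarrow> 'h"
    and comult :: "'h \<Rightarrow> ('h \<times> 'h) list set"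
    and counit :: "'h \<Rightarrow> 'k"
    and antipode :: "'h \<Rightarrow> 'h"
  assumes "hopf_algebra scale comult counit antipode"
    and "\<exists>B. finite_dimensional_vector_space scale B"
    and "semisimple_ring TYPE('h)"
  shows "((\<forall>x y :: 'h. x * y = y * x) \<longleftrightarrow>
          (\<exists>n\<ge>2. z_elem scale comult counit antipode n \<in> range (\<lambda>c. scale c 1)))
       \<and> ((\<exists>n\<ge>2. z_elem scale comult counit antipode n \<in> range (\<lambda>c. scale c 1)) \<longleftrightarrow>
          (\<forall>n\<ge>2. z_elem scale comult counit antipode n \<in> range (\<lambda>c. scale c 1)))"
proof -
  interpret hopf_algebra scale comult counit antipode by fact
  interpret semisimple_hopf_algebra scale comult counit antipode
    by unfold_locales (use assms(2,3) in auto)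
  have "\<forall>n\<ge>2. z n \<in> range (\<lambda>c. scale c 1)" if "\<forall>x y :: 'h. x * y = y * x"
    using z_commutative that by (auto intro!: range_eqI[of _ _ 1])
  moreover have "\<forall>x y :: 'h. x * y = y * x" if "\<exists>n\<ge>2. z n \<in> range (\<lambda>c. scale c 1)"
    using commutative_of_z_scalar that by blast
  ultimately show ?thesis by (metis order_refl)
qed

end
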